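(* Let $0<p\le 1/2$, $1/2\le s\le 1$ and $\epsilon>0$, and for each $m$ let $n=n(m)$ satisfy $n\ge(1+\epsilon)\,m\,(\log(1/p)+H(s))$. Let the hash function have the type-class statistical profile $P_H(b)=2^{-m(H(q(b))+D(q(b)\|p))}$ for all $b\in\{1,\dots,2^m\}$, let there be $M=2^{H(s)m-1}$ users (read as $\max\{1,\lfloor 2^{H(s)m-1}\rfloor\}$), let passwords be drawn i.i.d. Bernoulli$(1/2)$ bitwise, and let bins be allocated to the users and the hash function be modified by the backdoor mechanism described in the context. Then the average guesswork under a remote attack satisfies $$ \lim_{m\to\infty}\frac1m\log E(G_{remote}(B))=\begin{cases}H(s)+D(s\|p), & 1-p\le s\le 1,\\ 2H(p)+D(1-p\|p)-H(s), & 1/2\le s\le 1-p.\end{cases} $$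
   Context: Logarithms are base 2. $H(q)=-q\log q-(1-q)\log(1-q)$ is the binary entropy and $D(q\|p)=q\log\frac qp+(1-q)\log\frac{1-q}{1-p}$ (with $0\log0=0$). A hash function is a map $H_F:\{1,\dots,2^n\}\to\{1,\dots,2^m\}$, $n>m$; outputs are called bins and are identified with binary strings of length $m$. The type of a bin $b$ is $q(b)=N(1|b)/m$, with $N(1|b)$ the number of ones in $b$. The statistical profile of $H_F$ is $P_H(b)=2^{-n}|\{i:H_F(i)=b\}|$. For a given profile $P_H$ (so each $2^nP_H(b)$ is an integer), the $P_H$-set of hash functions is the set of all hash functions with profile $P_H$. Backdoor mechanism: order the bins $b_1,b_2,\dots$ from the least likely (smallest $P_H$) upward and allocate $b_i$ to user $i$, $1\le i\le M$. Each user independently draws a password $g\in\{1,\dots,2^n\}$ uniformly. If $g$ was not drawn by any user with a less likely allocated bin, the mapping of $g$ is replaced by $g\mapsto$ (the bin of this user). If $g$ was also drawn by a user with a less likely allocated bin, the mapping of $g$ is not changed again; instead the bin of the user is changed to the least likely bin among those allocated to users whose password is $g$. A guessing strategy is an ordering of the $2^n$ inputs; inputs are guessed one by one without repetition. Under a remote attack on a user, the number of guesses is the number up to and including the first guessed input which the (modified) hash function maps to the bin of that user. $E(G_{remote}(B))$ is the expected number of guesses averaged over the $M$ users, the expectation being over the passwords and, in addition, in either of two ways (the result is asserted for both): (i) for an arbitrary fixed strategy, over the original hash function drawn uniformly from the $P_H$-set; or (ii) for an arbitrary fixed original hash function in the $P_H$-set, over a uniformly random strategy. *)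

theory Defs
  imports "HOL-Probability.Probability" "HOL-Combinatorics.Permutations"
begin

text \<open>The convention \<open>0 log 0 = 0\<close> holds because a product with \<open>0\<close> is \<open>0\<close>.\<close>

definition binary_entropy :: "real \<Rightarrow> real" where
  "binary_entropy q = - q * log 2 q - (1 - q) * log 2 (1 - q)"

definition binary_divergence :: "real \<Rightarrow> real \<Rightarrow> real" where
  "binary_divergence q p = q * log 2 (q / p) + (1 - q) * log 2 ((1 - q) / (1 - p))"

definition inputs :: "nat \<Rightarrow> nat set" where
  "inputs n = {1..2 ^ n}"

definition bins :: "nat \<Rightarrow> bool list set" where
  "bins m = {b. length b = m}"

definition bin_type :: "bool list \<Rightarrow> real" where
  "bin_type b = real (count_list b True) / real (length b)"

definition hash_profile :: "nat \<Rightarrow> (nat \<Rightarrow> bool list) \<Rightarrow> bool list \<Rightarrow> real" where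
  "hash_profile n h b = real (card {i \<in> inputs n. h i = b}) / 2 ^ n"

text \<open>Hash functions are taken extensional, so that this set is finite and the uniform
  distribution on it makes sense.\<close>

definition profile_set :: "nat \<Rightarrow> nat \<Rightarrow> (bool list \<Rightarrow> real) \<Rightarrow> (nat \<Rightarrow> bool list) set" where
  "profile_set n m P = {h \<in> inputs n \<rightarrow>\<^sub>E bins m. \<forall>b \<in> bins m. hash_profile n h b = P b}"

definition type_profile :: "real \<Rightarrow> bool list \<Rightarrow> real" where
  "type_profile p b =
     2 powr (- (real (length b) * (binary_entropy (bin_type b) + binary_divergence (bin_type b) p)))"

definition num_users :: "real \<Rightarrow> nat \<Rightarrow> nat" where
  "num_users s m = max 1 (nat \<lfloor>2 powr (binary_entropy s * real m - 1)\<rfloor>)"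

text \<open>An enumeration of the bins from the least likely upward; equally likely bins may come in
  any order. User \<open>i\<close> is allocated the bin \<open>b i\<close>, and comparisons of likelihood between allocated
  bins are comparisons of positions in the enumeration.\<close>

definition bin_order :: "nat \<Rightarrow> (bool list \<Rightarrow> real) \<Rightarrow> (nat \<Rightarrow> bool list) \<Rightarrow> bool" where
  "bin_order m P b \<longleftrightarrow> bij_betw b {1..2 ^ m} (bins m) \<and> mono_on {1..2 ^ m} (\<lambda>i. P (b i))"

text \<open>Among the users \<open>1..M\<close> with passwords \<open>g\<close>, the one with the least likely allocated bin that
  drew the password \<open>x\<close>. Only this user's allocation takes effect on \<open>x\<close>.\<close>

definition owner :: "nat \<Rightarrow> (nat \<Rightarrow> nat) \<Rightarrow> nat \<Rightarrow> nat" where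
  "owner M g x = Min {j \<in> {1..M}. g j = x}"

definition backdoor_hash ::
    "nat \<Rightarrow> (nat \<Rightarrow> bool list) \<Rightarrow> (nat \<Rightarrow> nat) \<Rightarrow> (nat \<Rightarrow> bool list) \<Rightarrow> nat \<Rightarrow> bool list" where
  "backdoor_hash M b g h x = (if x \<in> g ` {1..M} then b (owner M g x) else h x)"

definition user_bin :: "nat \<Rightarrow> (nat \<Rightarrow> bool list) \<Rightarrow> (nat \<Rightarrow> nat) \<Rightarrow> nat \<Rightarrow> bool list" where
  "user_bin M b g i = b (owner M g (g i))"

text \<open>A strategy is a permutation of the inputs; its \<open>k\<close>-th guess is \<open>\<pi> k\<close>.\<close>

definition strategies :: "nat \<Rightarrow> (nat \<Rightarrow> nat) set" where
  "strategies n = {\<pi>. \<pi> permutes inputs n}"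

definition num_guesses :: "nat \<Rightarrow> (nat \<Rightarrow> nat) \<Rightarrow> (nat \<Rightarrow> bool list) \<Rightarrow> bool list \<Rightarrow> nat" where
  "num_guesses n \<pi> h c = Min {k \<in> {1..2 ^ n}. h (\<pi> k) = c}"

definition remote_average ::
    "nat \<Rightarrow> nat \<Rightarrow> (nat \<Rightarrow> bool list) \<Rightarrow> (nat \<Rightarrow> nat) \<Rightarrow> (nat \<Rightarrow> bool list) \<Rightarrow> (nat \<Rightarrow> nat) \<Rightarrow> real" where
  "remote_average n M b g h \<pi> =
     (\<Sum>i = 1..M. real (num_guesses n \<pi> (backdoor_hash M b g h) (user_bin M b g i))) / real M"

text \<open>I.i.d. uniform bits make each password uniform on the \<open>2 ^ n\<close> inputs.\<close>

definition passwords :: "nat \<Rightarrow> nat \<Rightarrow> (nat \<Rightarrow> nat) pmf" where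
  "passwords n M = Pi_pmf {1..M} 0 (\<lambda>_. pmf_of_set (inputs n))"

definition guesswork_random_hash ::
    "nat \<Rightarrow> nat \<Rightarrow> (bool list \<Rightarrow> real) \<Rightarrow> nat \<Rightarrow> (nat \<Rightarrow> bool list) \<Rightarrow> (nat \<Rightarrow> nat) \<Rightarrow> real" where
  "guesswork_random_hash n m P M b \<pi> =
     measure_pmf.expectation (pair_pmf (passwords n M) (pmf_of_set (profile_set n m P)))
       (\<lambda>(g, h). remote_average n M b g h \<pi>)"

definition guesswork_random_strategy ::
    "nat \<Rightarrow> nat \<Rightarrow> (nat \<Rightarrow> bool list) \<Rightarrow> (nat \<Rightarrow> bool list) \<Rightarrow> real" where
  "guesswork_random_strategy n M b h =
     measure_pmf.expectation (pair_pmf (passwords n M) (pmf_of_set (strategies n)))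
       (\<lambda>(g, \<pi>). remote_average n M b g h \<pi>)"

end

theory Submission
  imports Defs "HOL-Real_Asymp.Real_Asymp"
begin

text \<open>
  Under a random strategy the first element of a set of \<open>k\<close> out of \<open>N\<close> inputs comes at position
  \<open>(N + 1) / (k + 1)\<close> on average. The backdoor changes at most \<open>M\<close> inputs, and the lower bound on
  \<open>n\<close> makes every preimage have at least \<open>2 * M\<close> elements, so up to constant factors the guesswork
  for a bin \<open>c\<close> remains \<open>1 / P c\<close>. Two users collide with probability \<open>2 ^ - n\<close>, so their
  reallocation costs at most another constant factor and the guesswork is, up to constants, the average
  of \<open>1 / P\<close> over the \<open>M\<close> least likely bins. A fixed strategy against a random hash function
  reduces to this case, because relabelling the inputs preserves the profile set and the password
  distribution. The average is evaluated by the method of types: it is at least the contribution of the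
  single type \<open>max s (1 - p)\<close>, and a Chernoff bound shows that nothing exceeds this contribution.
\<close>

subsection \<open>Guessing with a random strategy\<close>

text \<open>Here \<open>\<sigma> x\<close> is the position at which \<open>x\<close> is guessed and
  \<open>S\<close> is the set of hits. The first hit is preceded exactly by the misses that come
  before all hits. Counting misses prepares for linearity of expectation.\<close>

lemma Min_eq_Suc_card_before:
  fixes S :: "nat set"
  assumes \<sigma>: "\<sigma> permutes {1..N}" and S: "S \<subseteq> {1..N}" "S \<noteq> {}"
  shows "Min (\<sigma> ` S) = Suc (card {x \<in> {1..N} - S. \<forall>y\<in>S. \<sigma> x < \<sigma> y})"
proof -
  have fin: "finite (\<sigma> ` S)" using S finite_subset by blast
  define k where "k = Min (\<sigma> ` S)"
  have k: "k \<in> \<sigma> ` S" "\<And>y. y \<in> S \<Longrightarrow> k \<le> \<sigma> y"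
    using fin S by (auto simp: k_def)
  have img: "\<sigma> ` {1..N} = {1..N}" using \<sigma> by (rule permutes_image)
  have "k \<in> {1..N}" using k(1) S(1) img by blast
  then have k1: "1 \<le> k" "k \<le> N" by auto
  have first: "\<sigma> ` {x \<in> {1..N} - S. \<forall>y\<in>S. \<sigma> x < \<sigma> y} = {1..<k}"
  proof (intro equalityI subsetI)
    fix z assume "z \<in> \<sigma> ` {x \<in> {1..N} - S. \<forall>y\<in>S. \<sigma> x < \<sigma> y}"
    then obtain x where x: "x \<in> {1..N}" "\<forall>y\<in>S. \<sigma> x < \<sigma> y" "z = \<sigma> x" by auto
    have "z \<in> {1..N}" using x img by blast
    moreover have "z < k" using x k(1) by auto
    ultimately show "z \<in> {1..<k}" by auto
  next
    fix z assume z: "z \<in> {1..<k}"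
    then have "z \<in> \<sigma> ` {1..N}" using img k1 by auto
    then obtain x where x: "x \<in> {1..N}" "z = \<sigma> x" by auto
    have "\<forall>y\<in>S. \<sigma> x < \<sigma> y" using z x k(2) by force
    then show "z \<in> \<sigma> ` {x \<in> {1..N} - S. \<forall>y\<in>S. \<sigma> x < \<sigma> y}" using x by auto
  qed
  have "inj_on \<sigma> {x \<in> {1..N} - S. \<forall>y\<in>S. \<sigma> x < \<sigma> y}"
    using permutes_inj[OF \<sigma>] by (rule inj_on_subset) simp
  from card_image[OF this] have "card {x \<in> {1..N} - S. \<forall>y\<in>S. \<sigma> x < \<sigma> y} = card {1..<k}"
    by (simp only: first)
  then show ?thesis using k1 by (simp add: k_def)
qed

text \<open>By symmetry every element of \<open>insert x S\<close> is equally likely to come first.\<close>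

lemma card_permutes_first:
  fixes S A :: "nat set"
  assumes fA: "finite A" and S: "S \<subseteq> A" and x: "x \<in> A - S"
  shows "Suc (card S) * card {\<sigma>. \<sigma> permutes A \<and> (\<forall>y\<in>S. \<sigma> x < \<sigma> y)} = card {\<sigma>. \<sigma> permutes A}"
proof -
  define T where "T = insert x S"
  define E where "E z = {\<sigma>. \<sigma> permutes A \<and> (\<forall>y\<in>T - {z}. \<sigma> z < \<sigma> y)}" for z
  have fin: "finite {\<sigma>. \<sigma> permutes A}" using fA by (rule finite_permutations)
  have finE: "finite (E z)" for z
    by (rule finite_subset[OF _ fin]) (auto simp: E_def)
  have fT: "finite T" using fA S finite_subset T_def by auto
  have TA: "T \<subseteq> A" using S x T_def by auto
  \<comment> \<open>\<open>E z\<close> is the event that \<open>z\<close> comes first in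
    \<open>T\<close>. Precomposing with the transposition exchanges the roles of \<open>z\<close>
    and \<open>w\<close>, so each event injects into any other and all have the same size.\<close>
  have sub: "card (E z) \<le> card (E w)" if "z \<in> T" "w \<in> T" for z w
  proof -
    let ?t = "Transposition.transpose z w"
    have t: "?t permutes A" using that TA by (intro permutes_swap_id) auto
    have "(\<lambda>\<sigma>. \<sigma> \<circ> ?t) ` E z \<subseteq> E w"
    proof (clarify)
      fix \<sigma> assume \<sigma>: "\<sigma> \<in> E z"
      have "(\<sigma> \<circ> ?t) w < (\<sigma> \<circ> ?t) y" if "y \<in> T - {w}" for y
        using \<sigma> that \<open>z \<in> T\<close> \<open>w \<in> T\<close> by (auto simp: E_def Transposition.transpose_def)
      moreover have "\<sigma> \<circ> ?t permutes A" using \<sigma> t by (auto simp: E_def intro: permutes_compose)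
      ultimately show "\<sigma> \<circ> ?t \<in> E w" by (auto simp: E_def)
    qed
    moreover have "inj_on (\<lambda>\<sigma>. \<sigma> \<circ> ?t) (E z)"
      by (rule inj_on_inverseI[where g = "\<lambda>\<sigma>. \<sigma> \<circ> ?t"]) (simp add: comp_assoc)
    ultimately show ?thesis using finE by (metis card_inj_on_le)
  qed
  have "{\<sigma>. \<sigma> permutes A} = (\<Union>z\<in>T. E z)"
  proof (intro equalityI subsetI)
    fix \<sigma> assume \<sigma>: "\<sigma> \<in> {\<sigma>. \<sigma> permutes A}"
    have inj: "inj \<sigma>" using \<sigma> by (auto intro: permutes_inj)
    have "Min (\<sigma> ` T) \<in> \<sigma> ` T" using fT T_def by (intro Min_in) auto
    then obtain z where z: "z \<in> T" "\<sigma> z = Min (\<sigma> ` T)" by auto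
    have "\<sigma> z < \<sigma> y" if "y \<in> T - {z}" for y
    proof -
      have "\<sigma> z \<le> \<sigma> y" using z fT that by auto
      moreover have "\<sigma> z \<noteq> \<sigma> y" using inj that by (auto dest: injD)
      ultimately show ?thesis by simp
    qed
    then have "\<sigma> \<in> E z" using \<sigma> by (simp add: E_def)
    then show "\<sigma> \<in> (\<Union>z\<in>T. E z)" using z by blast
  qed (auto simp: E_def)
  moreover have "card (\<Union>z\<in>T. E z) = (\<Sum>z\<in>T. card (E z))"
  proof (intro card_UN_disjoint ballI impI)
    fix z w assume zw: "z \<in> T" "w \<in> T" "z \<noteq> w"
    show "E z \<inter> E w = {}"
    proof (rule equals0I)
      fix \<sigma> assume "\<sigma> \<in> E z \<inter> E w"
      then have "\<sigma> z < \<sigma> w" "\<sigma> w < \<sigma> z" using zw by (auto simp: E_def)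
      then show False by simp
    qed
  qed (use fT finE in auto)
  moreover have "(\<Sum>z\<in>T. card (E z)) = (\<Sum>z\<in>T. card (E x))"
    using sub by (intro sum.cong refl antisym) (auto simp: T_def)
  moreover have "card T = Suc (card S)" using fT x by (auto simp: T_def)
  moreover have "E x = {\<sigma>. \<sigma> permutes A \<and> (\<forall>y\<in>S. \<sigma> x < \<sigma> y)}"
    using x by (auto simp: E_def T_def)
  ultimately show ?thesis by simp
qed

text \<open>Linearity of expectation: with \<open>k = card S\<close>, each of the
  \<open>N - k\<close> misses precedes all hits with probability \<open>1 / (k + 1)\<close>, and
  \<open>1 + (N - k) / (k + 1) = (N + 1) / (k + 1)\<close>.\<close>

lemma sum_permutes_Min_image:
  fixes S :: "nat set"
  assumes S: "S \<subseteq> {1..N}" "S \<noteq> {}"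
  shows "(\<Sum>\<sigma> | \<sigma> permutes {1..N}. real (Min (\<sigma> ` S)))
    = real (card {\<sigma>. \<sigma> permutes {1..N}}) * (real N + 1) / (real (card S) + 1)"
proof -
  let ?Q = "{\<sigma>. \<sigma> permutes {1..N}}"
  have fin: "finite ?Q" by (rule finite_permutations) simp
  have fS: "finite S" "card S \<le> N" using S finite_subset card_mono[of "{1..N}" S] by auto
  have eq: "real (card {\<sigma>. \<sigma> permutes {1..N} \<and> (\<forall>y\<in>S. \<sigma> x < \<sigma> y)})
    = real (card ?Q) / (real (card S) + 1)" if "x \<in> {1..N} - S" for x
  proof -
    have "real (Suc (card S) * card {\<sigma>. \<sigma> permutes {1..N} \<and> (\<forall>y\<in>S. \<sigma> x < \<sigma> y)}) = real (card ?Q)"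
      using card_permutes_first[of "{1..N}" S x] S that by simp
    then show ?thesis by (simp add: field_simps)
  qed
  have "(\<Sum>\<sigma>\<in>?Q. real (Min (\<sigma> ` S)))
    = (\<Sum>\<sigma>\<in>?Q. 1 + (\<Sum>x\<in>{1..N} - S. if \<forall>y\<in>S. \<sigma> x < \<sigma> y then 1 else 0))"
    by (rule sum.cong) (auto simp: Min_eq_Suc_card_before[OF _ S] sum.If_cases Int_def)
  also have "\<dots> = real (card ?Q)
      + (\<Sum>x\<in>{1..N} - S. \<Sum>\<sigma>\<in>?Q. if \<forall>y\<in>S. \<sigma> x < \<sigma> y then 1 else 0)"
    by (subst sum.swap) (simp add: sum.distrib)
  also have "(\<Sum>x\<in>{1..N} - S. \<Sum>\<sigma>\<in>?Q. if \<forall>y\<in>S. \<sigma> x < \<sigma> y then 1 else 0)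
      = (\<Sum>x\<in>{1..N} - S. real (card {\<sigma>. \<sigma> permutes {1..N} \<and> (\<forall>y\<in>S. \<sigma> x < \<sigma> y)}))"
    using fin by (intro sum.cong refl) (simp add: sum.If_cases Int_def)
  also have "\<dots> = real (N - card S) * (real (card ?Q) / (real (card S) + 1))"
    using S fS by (simp add: eq card_Diff_subset del: One_nat_def)
  also have "real (card ?Q) + \<dots> = real (card ?Q) * (real N + 1) / (real (card S) + 1)"
    using fS by (simp add: field_simps)
  finally show ?thesis .
qed

text \<open>The inverse of a strategy sends inputs to their positions, and inversion permutes the
  set of strategies. The witness \<open>x\<close> keeps \<open>Min\<close> away from the empty
  set.\<close>

lemma sum_num_guesses:
  assumes ne: "x \<in> inputs n" "h x = c"
  shows "(\<Sum>\<pi>\<in>strategies n. real (num_guesses n \<pi> h c))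
    = real (card (strategies n)) * (2 ^ n + 1) / (real (card {x \<in> inputs n. h x = c}) + 1)"
proof -
  let ?S = "{x \<in> inputs n. h x = c}"
  have eq: "{k \<in> {1..2 ^ n}. h (\<pi> k) = c} = inv \<pi> ` ?S" if "\<pi> permutes {1..2 ^ n}" for \<pi>
  proof (intro equalityI subsetI)
    fix k assume "k \<in> {k \<in> {1..2 ^ n}. h (\<pi> k) = c}"
    then show "k \<in> inv \<pi> ` ?S"
      using that permutes_in_image[OF that] permutes_inverses(2)[OF that]
      by (intro image_eqI[of _ _ "\<pi> k"]) (auto simp: inputs_def simp del: atLeastAtMost_iff)
  next
    fix k assume "k \<in> inv \<pi> ` ?S"
    then show "k \<in> {k \<in> {1..2 ^ n}. h (\<pi> k) = c}"
      using permutes_in_image[OF permutes_inv[OF that]] permutes_inverses(1)[OF that]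
      by (auto simp: inputs_def simp del: atLeastAtMost_iff)
  qed
  have "(\<Sum>\<pi>\<in>strategies n. real (num_guesses n \<pi> h c))
    = (\<Sum>\<pi> | \<pi> permutes {1..2 ^ n}. real (Min (inv \<pi> ` ?S)))"
    unfolding num_guesses_def strategies_def inputs_def
    by (rule sum.cong[OF refl]) (simp only: mem_Collect_eq eq[unfolded inputs_def])
  also have "\<dots> = (\<Sum>\<pi> | \<pi> permutes {1..2 ^ n}. real (Min (\<pi> ` ?S)))"
    by (rule sum_permutations_inverse[symmetric])
  also have "\<dots> = real (card (strategies n)) * (2 ^ n + 1) / (real (card ?S) + 1)"
    using ne by (subst sum_permutes_Min_image) (auto simp: inputs_def strategies_def)
  finally show ?thesis .
qed

subsection \<open>The effect of the backdoor\<close>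

text \<open>This is the support of \<open>passwords\<close>. Outside \<open>{1..M}\<close> the
  vectors take the default value \<open>0\<close> of \<open>Pi_pmf\<close>; it is not an input, so
  relabelling the inputs fixes it.\<close>

definition password_vectors :: "nat \<Rightarrow> nat \<Rightarrow> (nat \<Rightarrow> nat) set" where
  "password_vectors n M = PiE_dflt {1..M} 0 (\<lambda>_. inputs n)"

lemma finite_inputs [simp]: "finite (inputs n)"
  and inputs_nonempty [simp]: "inputs n \<noteq> {}"
  and card_inputs [simp]: "card (inputs n) = 2 ^ n"
  by (auto simp: inputs_def)

lemma finite_password_vectors [simp]: "finite (password_vectors n M)"
  unfolding password_vectors_def by (rule finite_PiE_dflt) auto

lemma password_vectors_nonempty [simp]: "password_vectors n M \<noteq> {}"
proof -
  have "(\<lambda>i. if i \<in> {1..M} then 1 else 0) \<in> password_vectors n M"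
    by (auto simp: password_vectors_def PiE_dflt_def inputs_def)
  then show ?thesis by blast
qed

lemma passwords_eq: "passwords n M = pmf_of_set (password_vectors n M)"
  unfolding passwords_def password_vectors_def by (rule Pi_pmf_of_set) auto

lemma pair_pmf_of_set:
  assumes "finite A" "A \<noteq> {}" "finite B" "B \<noteq> {}"
  shows "pair_pmf (pmf_of_set A) (pmf_of_set B) = pmf_of_set (A \<times> B)"
proof (rule pmf_eqI)
  fix z :: "'a \<times> 'b"
  show "pmf (pair_pmf (pmf_of_set A) (pmf_of_set B)) z = pmf (pmf_of_set (A \<times> B)) z"
    using assms by (cases z) (auto simp: pmf_pair indicator_def)
qed

lemma finite_strategies [simp]: "finite (strategies n)"
  and strategies_nonempty [simp]: "strategies n \<noteq> {}"
  unfolding strategies_def by (auto intro: finite_permutations exI[of _ id] permutes_id)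

lemma guesswork_random_strategy_eq_sum:
  "guesswork_random_strategy n M b h
    = (\<Sum>g\<in>password_vectors n M. \<Sum>\<pi>\<in>strategies n. remote_average n M b g h \<pi>)
        / (real (card (password_vectors n M)) * real (card (strategies n)))"
  unfolding guesswork_random_strategy_def passwords_eq
  by (simp add: pair_pmf_of_set integral_pmf_of_set sum.cartesian_product card_cartesian_product)

lemma owner_props:
  assumes "i \<in> {1..M}"
  shows "owner M g (g i) \<in> {1..M}" "g (owner M g (g i)) = g i" "owner M g (g i) \<le> i"
proof -
  have "owner M g (g i) \<in> {j \<in> {1..M}. g j = g i}"
    unfolding owner_def using assms by (intro Min_in) auto
  then show "owner M g (g i) \<in> {1..M}" "g (owner M g (g i)) = g i" by auto
  show "owner M g (g i) \<le> i"
    unfolding owner_def using assms by (intro Min_le) auto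
qed

text \<open>After the modification the password of a user is always mapped to the bin of this user,
  so the preimage is nonempty and \<open>sum_num_guesses\<close> applies to every summand.\<close>

lemma sum_strategies_remote_average:
  assumes g: "g \<in> password_vectors n M"
  shows "(\<Sum>\<pi>\<in>strategies n. remote_average n M b g h \<pi>)
    = real (card (strategies n)) *
      ((\<Sum>i = 1..M. (2 ^ n + 1) /
          (real (card {x \<in> inputs n. backdoor_hash M b g h x = user_bin M b g i}) + 1)) / real M)"
proof -
  have "(\<Sum>\<pi>\<in>strategies n. real (num_guesses n \<pi> (backdoor_hash M b g h) (user_bin M b g i)))
    = real (card (strategies n)) * ((2 ^ n + 1) /
          (real (card {x \<in> inputs n. backdoor_hash M b g h x = user_bin M b g i}) + 1))"
    if "i \<in> {1..M}" for i
  proof -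
    have "g i \<in> inputs n" using g that by (auto simp: password_vectors_def PiE_dflt_def)
    moreover have "backdoor_hash M b g h (g i) = user_bin M b g i"
      using that by (auto simp: backdoor_hash_def user_bin_def)
    ultimately show ?thesis by (subst sum_num_guesses) auto
  qed
  then have "(\<Sum>i = 1..M. \<Sum>\<pi>\<in>strategies n.
        real (num_guesses n \<pi> (backdoor_hash M b g h) (user_bin M b g i)))
    = real (card (strategies n)) * (\<Sum>i = 1..M. (2 ^ n + 1) /
          (real (card {x \<in> inputs n. backdoor_hash M b g h x = user_bin M b g i}) + 1))"
    unfolding sum_distrib_left by (rule sum.cong[OF refl])
  then show ?thesis
    unfolding remote_average_def sum_divide_distrib[symmetric] by (subst sum.swap) simp
qed

text \<open>The users' passwords move at most \<open>M\<close> inputs out of the preimage of a bin, and only the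
  password of the bin's owner into it.\<close>

lemma card_backdoor_preimage:
  fixes h :: "nat \<Rightarrow> bool list"
  assumes g: "g \<in> password_vectors n M" and b: "inj_on b {1..M}" and i: "i \<in> {1..M}"
  defines "S \<equiv> {x \<in> inputs n. backdoor_hash M b g h x = user_bin M b g i}"
    and "K \<equiv> {x \<in> inputs n. h x = b (owner M g (g i))}"
  shows "card S \<le> Suc (card K)" "card K \<le> card S + M"
proof -
  have fin: "finite S" "finite K" by (auto simp: S_def K_def)
  have "S \<subseteq> insert (g i) K"
  proof
    fix x assume x: "x \<in> S"
    show "x \<in> insert (g i) K"
    proof (cases "x \<in> g ` {1..M}")
      case True
      then obtain l where l: "l \<in> {1..M}" "x = g l" by auto
      \<comment> \<open>Distinct owners hold distinct bins, so an overwritten input that carries the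
        bin of user \<open>i\<close> can only be the password of user \<open>i\<close>.\<close>
      have "b (owner M g (g l)) = b (owner M g (g i))"
        using x l by (auto simp: S_def backdoor_hash_def user_bin_def)
      then have "owner M g (g l) = owner M g (g i)"
        by (rule inj_onD[OF b _ owner_props(1)[OF l(1)] owner_props(1)[OF i]])
      then have "g l = g i" using owner_props(2)[OF l(1), of g] owner_props(2)[OF i, of g] by argo
      then show ?thesis using l by simp
    next
      case False
      then show ?thesis using x by (auto simp: S_def K_def backdoor_hash_def user_bin_def)
    qed
  qed
  then have "card S \<le> card (insert (g i) K)" using fin by (intro card_mono) auto
  then show "card S \<le> Suc (card K)" using fin by (simp add: card_insert_if split: if_splits)
  have "K \<subseteq> S \<union> g ` {1..M}"
    by (auto simp: S_def K_def backdoor_hash_def user_bin_def)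
  then have "card K \<le> card (S \<union> g ` {1..M})" using fin by (intro card_mono) auto
  also have "\<dots> \<le> card S + card (g ` {1..M})" by (rule card_Un_le)
  also have "\<dots> \<le> card S + M" using card_image_le[of "{1..M}" g] by simp
  finally show "card K \<le> card S + M" .
qed

text \<open>In a colliding vector the entry at \<open>i\<close> is determined by the entry at
  \<open>j\<close>. Overwriting it with an arbitrary input therefore yields \<open>2 ^ n\<close>
  vectors per collision, all distinct.\<close>

lemma card_password_collision:
  assumes "i \<in> {1..M}" "j \<in> {1..M}" "i \<noteq> j"
  shows "2 ^ n * card {g \<in> password_vectors n M. g j = g i} \<le> card (password_vectors n M)"
proof -
  let ?C = "{g \<in> password_vectors n M. g j = g i}"
  let ?f = "\<lambda>(g, x). (g :: nat \<Rightarrow> nat)(i := x)"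
  have "inj_on ?f (?C \<times> inputs n)"
  proof (rule inj_onI, clarify)
    fix g g' :: "nat \<Rightarrow> nat" and x x'
    assume eq: "g(i := x) = g'(i := x')" and c: "g j = g i" "g' j = g' i"
    have *: "g l = g' l" if "l \<noteq> i" for l using fun_cong[OF eq, of l] that by simp
    moreover have "g i = g' i" using *[of j] c assms by simp
    ultimately have "g = g'" by (metis ext)
    moreover have "x = x'" using fun_cong[OF eq, of i] by simp
    ultimately show "g = g' \<and> x = x'" by simp
  qed
  moreover have "?f ` (?C \<times> inputs n) \<subseteq> password_vectors n M"
    using assms by (auto simp: password_vectors_def PiE_dflt_def)
  ultimately have "card (?C \<times> inputs n) \<le> card (password_vectors n M)"
    by (intro card_inj_on_le) auto
  then show ?thesis by (simp add: card_cartesian_product mult.commute)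
qed

text \<open>A union bound: the owner is \<open>i\<close> or some other \<open>j\<close> whose
  password collides with that of \<open>i\<close>, and each such collision has probability at most
  \<open>1 / 2 ^ n\<close>.\<close>

lemma sum_owner_le:
  fixes u :: "nat \<Rightarrow> real"
  assumes i: "i \<in> {1..M}" and u: "\<And>j. j \<in> {1..M} \<Longrightarrow> 0 \<le> u j"
  shows "(\<Sum>g\<in>password_vectors n M. u (owner M g (g i)))
    \<le> real (card (password_vectors n M)) * (u i + (\<Sum>j = 1..M. u j) / 2 ^ n)"
proof -
  let ?V = "password_vectors n M"
  have "(\<Sum>g\<in>?V. u (owner M g (g i))) \<le> (\<Sum>g\<in>?V. \<Sum>j = 1..M. if g j = g i then u j else 0)"
  proof (rule sum_mono)
    fix g
    have "(if g (owner M g (g i)) = g i then u (owner M g (g i)) else 0)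
        \<le> (\<Sum>j = 1..M. if g j = g i then u j else 0)"
      by (rule member_le_sum) (use owner_props(1)[OF i] u in auto)
    then show "u (owner M g (g i)) \<le> (\<Sum>j = 1..M. if g j = g i then u j else 0)"
      using owner_props(2)[OF i] by simp
  qed
  also have "\<dots> = (\<Sum>j = 1..M. u j * real (card {g \<in> ?V. g j = g i}))"
    by (subst sum.swap) (simp add: sum.If_cases Int_def mult.commute)
  also have "\<dots> \<le> (\<Sum>j = 1..M. (if j = i then real (card ?V) * u i else 0)
                      + real (card ?V) * (u j / 2 ^ n))"
  proof (rule sum_mono)
    fix j assume j: "j \<in> {1..M}"
    show "u j * real (card {g \<in> ?V. g j = g i})
      \<le> (if j = i then real (card ?V) * u i else 0) + real (card ?V) * (u j / 2 ^ n)"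
    proof (cases "j = i")
      case True
      then show ?thesis using u[OF i] by simp
    next
      case False
      have "real (2 ^ n * card {g \<in> ?V. g j = g i}) \<le> real (card ?V)"
        using card_password_collision[OF i j] False by (intro of_nat_mono) auto
      then have "real (card {g \<in> ?V. g j = g i}) \<le> real (card ?V) / 2 ^ n"
        by (simp add: field_simps)
      from mult_left_mono[OF this u[OF j]] show ?thesis using False by (simp add: mult.commute)
    qed
  qed
  also have "\<dots> = real (card ?V) * (u i + (\<Sum>j = 1..M. u j) / 2 ^ n)"
    using i by (simp add: sum.distrib sum_distrib_left[symmetric] sum_divide_distrib[symmetric] distrib_left)
  finally show ?thesis .
qed

text \<open>\<open>N\<close> is the number of inputs, \<open>K\<close> and \<open>S\<close> are the
  preimage sizes before and after the modification, and \<open>M\<close> is the number of users.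
  From \<open>2 * M \<le> K\<close> it follows that \<open>K / 2 \<le> S\<close> and
  \<open>S + 1 \<le> 2 * K\<close>.\<close>

lemma guesses_sandwich:
  fixes N K S M :: real
  assumes "K \<le> S + M" "S \<le> K + 1" "2 * M \<le> K" "1 \<le> M" "K \<le> N"
  shows "N / K / 2 \<le> (N + 1) / (S + 1)" "(N + 1) / (S + 1) \<le> 2 * (N / K)"
proof -
  have pos: "2 \<le> K" "0 < S + 1" using assms by auto
  have "N * (S + 1) \<le> N * (2 * K)" using assms pos by (intro mult_left_mono) auto
  also have "\<dots> \<le> (N + 1) * (2 * K)" using pos by (intro mult_right_mono) auto
  finally show "N / K / 2 \<le> (N + 1) / (S + 1)" using pos by (simp add: field_simps)
  have "(N + 1) * K \<le> N * (K + 2)" using assms by (simp add: algebra_simps)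
  also have "\<dots> \<le> N * (2 * (S + 1))" using assms pos by (intro mult_left_mono) auto
  finally show "(N + 1) / (S + 1) \<le> 2 * (N / K)" using pos by (simp add: field_simps)
qed

text \<open>An owner never comes later in the bin order than the user, so reallocation only
  increases \<open>1 / P\<close>; with the factor \<open>2\<close> of
  \<open>guesses_sandwich\<close> this gives the lower bound. Above, collisions contribute a further
  factor \<open>1 + M / 2 ^ n \<le> 2\<close>, hence the \<open>4\<close>.\<close>

lemma guesswork_random_strategy_bounds:
  assumes b: "bin_order m P b" and h: "h \<in> profile_set n m P"
    and M: "1 \<le> M" "M \<le> 2 ^ m" and big: "\<And>c. c \<in> bins m \<Longrightarrow> 2 * real M \<le> 2 ^ n * P c"
  defines "A \<equiv> (\<Sum>i = 1..M. 1 / P (b i)) / real M"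
  shows "A / 2 \<le> guesswork_random_strategy n M b h" "guesswork_random_strategy n M b h \<le> 4 * A"
proof -
  let ?V = "password_vectors n M"
  define u where "u i = 1 / P (b i)" for i
  define S where "S g i = {x \<in> inputs n. backdoor_hash M b g h x = user_bin M b g i}" for g i
  have sub: "{1..M} \<subseteq> {1..2 ^ m}" using M by auto
  have bb: "bij_betw b {1..2 ^ m} (bins m)" and mono: "mono_on {1..2 ^ m} (\<lambda>i. P (b i))"
    using b by (auto simp: bin_order_def)
  have inj: "inj_on b {1..M}" using bb sub by (auto simp: bij_betw_def intro: inj_on_subset)
  have bin: "b i \<in> bins m" if "i \<in> {1..M}" for i using bb sub that by (auto simp: bij_betw_def)
  have K: "real (card {x \<in> inputs n. h x = c}) = 2 ^ n * P c" if "c \<in> bins m" for c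
    using h that by (auto simp: profile_set_def hash_profile_def field_simps)
  have Ppos: "0 < P c" if "c \<in> bins m" for c
  proof -
    have "0 < 2 ^ n * P c" using big[OF that] M by linarith
    then show ?thesis by (simp add: zero_less_mult_iff)
  qed
  have upos: "0 < u i" if "i \<in> {1..M}" for i using Ppos[OF bin[OF that]] by (simp add: u_def)
  have anti: "u i \<le> u (owner M g (g i))" if "i \<in> {1..M}" for g i
  proof -
    have "owner M g (g i) \<in> {1..2 ^ m}" "i \<in> {1..2 ^ m}" "owner M g (g i) \<le> i"
      using owner_props[OF that] sub that by blast+
    with mono have "P (b (owner M g (g i))) \<le> P (b i)" by (rule mono_onD)
    then show ?thesis
      using Ppos bin[OF that] bin[OF owner_props(1)[OF that]] by (simp add: u_def frac_le)
  qed
  have sand: "u (owner M g (g i)) / 2 \<le> (2 ^ n + 1) / (real (card (S g i)) + 1)"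
             "(2 ^ n + 1) / (real (card (S g i)) + 1) \<le> 2 * u (owner M g (g i))"
    if g: "g \<in> ?V" and i: "i \<in> {1..M}" for g i
  proof -
    let ?c = "b (owner M g (g i))"
    have c: "?c \<in> bins m" by (rule bin) (rule owner_props(1)[OF i])
    have "card {x \<in> inputs n. h x = ?c} \<le> card (inputs n)" by (intro card_mono) auto
    then have "real (card {x \<in> inputs n. h x = ?c}) \<le> 2 ^ n"
      by (metis card_inputs of_nat_mono of_nat_numeral of_nat_power)
    then have KN: "2 ^ n * P ?c \<le> 2 ^ n" using K[OF c] by simp
    have eq: "2 ^ n / (2 ^ n * P ?c) = u (owner M g (g i))" by (simp add: u_def)
    have K1: "2 ^ n * P ?c \<le> real (card (S g i)) + real M" "real (card (S g i)) \<le> 2 ^ n * P ?c + 1"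
      using card_backdoor_preimage[OF g inj i, of h] K[OF c] unfolding S_def by linarith+
    have M1: "1 \<le> real M" using M by simp
    show "u (owner M g (g i)) / 2 \<le> (2 ^ n + 1) / (real (card (S g i)) + 1)"
         "(2 ^ n + 1) / (real (card (S g i)) + 1) \<le> 2 * u (owner M g (g i))"
      using guesses_sandwich[OF K1 big[OF c] M1 KN] unfolding eq by auto
  qed
  define X where "X = (\<Sum>g\<in>?V. \<Sum>i = 1..M. (2 ^ n + 1) / (real (card (S g i)) + 1))"
  have V: "0 < real (card ?V)" and F: "0 < real (card (strategies n))"
    by (simp_all add: card_gt_0_iff)
  have G: "guesswork_random_strategy n M b h = X / (real (card ?V) * real M)"
    unfolding guesswork_random_strategy_eq_sum X_def S_def using F
    by (simp add: sum_strategies_remote_average sum_distrib_left[symmetric] sum_divide_distrib[symmetric])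
  have A: "A = (\<Sum>i = 1..M. u i) / real M" by (simp add: A_def u_def)
  have "(\<Sum>g\<in>?V. \<Sum>i = 1..M. u i / 2) \<le> X"
    unfolding X_def
  proof (intro sum_mono)
    fix g i assume gi: "g \<in> ?V" "i \<in> {1..M}"
    show "u i / 2 \<le> (2 ^ n + 1) / (real (card (S g i)) + 1)"
      using sand(1)[OF gi] anti[OF gi(2), of g] by linarith
  qed
  then have "real (card ?V) * (\<Sum>i = 1..M. u i) / 2 \<le> X"
    by (simp add: sum_divide_distrib[symmetric])
  then show "A / 2 \<le> guesswork_random_strategy n M b h"
    using V M by (simp add: G A field_simps)
  have "X \<le> (\<Sum>i = 1..M. 2 * (\<Sum>g\<in>?V. u (owner M g (g i))))"
    unfolding X_def sum_distrib_left using sand(2) by (subst sum.swap) (intro sum_mono, auto)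
  also have "\<dots> \<le> (\<Sum>i = 1..M. 2 * (real (card ?V) * (u i + (\<Sum>j = 1..M. u j) / 2 ^ n)))"
    using upos by (intro sum_mono mult_left_mono sum_owner_le) (auto simp: less_imp_le)
  also have "\<dots> = 2 * real (card ?V) * ((1 + real M / 2 ^ n) * (\<Sum>i = 1..M. u i))"
    by (simp only: sum_distrib_left[symmetric] sum.distrib) (simp add: algebra_simps)
  also have "\<dots> \<le> 2 * real (card ?V) * (2 * (\<Sum>i = 1..M. u i))"
  proof (intro mult_left_mono mult_right_mono)
    have c: "b 1 \<in> bins m" using bin M by auto
    have "card {x \<in> inputs n. h x = b 1} \<le> card (inputs n)" by (intro card_mono) auto
    then have "real (card {x \<in> inputs n. h x = b 1}) \<le> 2 ^ n"
      by (metis card_inputs of_nat_mono of_nat_numeral of_nat_power)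
    then have "real M \<le> 2 ^ n" using big[OF c] K[OF c] by linarith
    then show "1 + real M / 2 ^ n \<le> 2" by simp
    show "0 \<le> (\<Sum>i = 1..M. u i)" using upos by (intro sum_nonneg less_imp_le) blast
  qed auto
  finally show "guesswork_random_strategy n M b h \<le> 4 * A"
    using V M by (simp add: G A field_simps)
qed

subsection \<open>Random hash functions\<close>

lemma finite_profile_set [simp]: "finite (profile_set n m P)"
proof -
  have "finite {b :: bool list. set b \<subseteq> UNIV \<and> length b = m}"
    by (rule finite_lists_length_eq) simp
  then have "finite (bins m)" by (simp add: bins_def)
  then have "finite (inputs n \<rightarrow>\<^sub>E bins m)" by (intro finite_PiE) auto
  then show ?thesis by (rule finite_subset[rotated]) (auto simp: profile_set_def)
qed

lemma profile_set_comp: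
  assumes \<sigma>: "\<sigma> permutes inputs n" and h: "h \<in> profile_set n m P"
  shows "h \<circ> \<sigma> \<in> profile_set n m P"
proof -
  have im: "\<sigma> x \<in> inputs n \<longleftrightarrow> x \<in> inputs n" for x by (rule permutes_in_image[OF \<sigma>])
  have "h \<circ> \<sigma> \<in> inputs n \<rightarrow>\<^sub>E bins m"
  proof (intro PiE_I)
    fix x assume "x \<in> inputs n" then show "(h \<circ> \<sigma>) x \<in> bins m"
      using h im by (auto simp: profile_set_def)
  next
    fix x assume x: "x \<notin> inputs n"
    then have "\<sigma> x = x" using \<sigma> by (auto simp: permutes_def)
    then show "(h \<circ> \<sigma>) x = undefined" using h x by (auto simp: profile_set_def PiE_def extensional_def)
  qed
  moreover have "hash_profile n (h \<circ> \<sigma>) b = hash_profile n h b" for b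
  proof -
    have "{i \<in> inputs n. h i = b} = \<sigma> ` {i \<in> inputs n. (h \<circ> \<sigma>) i = b}"
    proof (intro equalityI subsetI)
      fix i assume i: "i \<in> {i \<in> inputs n. h i = b}"
      show "i \<in> \<sigma> ` {i \<in> inputs n. (h \<circ> \<sigma>) i = b}"
        using i im[of "inv \<sigma> i"] permutes_inverses(1)[OF \<sigma>]
        by (intro image_eqI[of _ _ "inv \<sigma> i"]) auto
    qed (use im in auto)
    moreover have "inj_on \<sigma> {i \<in> inputs n. (h \<circ> \<sigma>) i = b}"
      using permutes_inj[OF \<sigma>] by (rule inj_on_subset) simp
    ultimately show ?thesis by (simp add: hash_profile_def card_image)
  qed
  ultimately show ?thesis using h by (simp add: profile_set_def)
qed

lemma password_vectors_comp:
  assumes \<sigma>: "\<sigma> permutes inputs n" and g: "g \<in> password_vectors n M"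
  shows "\<sigma> \<circ> g \<in> password_vectors n M"
proof -
  have "\<sigma> 0 = 0" using \<sigma> by (auto simp: permutes_def inputs_def)
  then show ?thesis
    using g permutes_in_image[OF \<sigma>] by (auto simp: password_vectors_def PiE_dflt_def)
qed

text \<open>Owners depend only on which passwords coincide, so an injective relabelling preserves
  them and the bins of the users. The modified hash function is merely precomposed with
  \<open>inv \<sigma>\<close>, which the strategy can absorb.\<close>

lemma remote_average_relabel:
  assumes \<sigma>: "\<sigma> permutes inputs n"
  shows "remote_average n M b (\<sigma> \<circ> g) (h \<circ> inv \<sigma>) \<pi> = remote_average n M b g h (inv \<sigma> \<circ> \<pi>)"
proof -
  have i: "\<sigma> x = \<sigma> y \<longleftrightarrow> x = y" for x y using permutes_inj[OF \<sigma>] by (auto dest: injD)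
  have o: "owner M (\<sigma> \<circ> g) (\<sigma> x) = owner M g x" for x by (simp add: owner_def i)
  have u: "user_bin M b (\<sigma> \<circ> g) j = user_bin M b g j" for j using o[of "g j"] by (simp add: user_bin_def)
  have "backdoor_hash M b (\<sigma> \<circ> g) (h \<circ> inv \<sigma>) (\<sigma> x) = backdoor_hash M b g h x" for x
    using permutes_inverses(2)[OF \<sigma>] by (auto simp: backdoor_hash_def o i)
  then have "backdoor_hash M b (\<sigma> \<circ> g) (h \<circ> inv \<sigma>) y = backdoor_hash M b g h (inv \<sigma> y)" for y
    by (metis permutes_inverses(1)[OF \<sigma>])
  then show ?thesis by (simp add: remote_average_def num_guesses_def u)
qed

text \<open>By relabelling, the sum over passwords and hash functions is the same for all
  strategies. It may thus be replaced by its average over strategies, and exchanging the sums leads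
  to the guesswork of a random strategy.\<close>

lemma guesswork_random_hash_eq_average:
  assumes ne: "profile_set n m P \<noteq> {}" and \<pi>: "\<pi> \<in> strategies n"
  shows "guesswork_random_hash n m P M b \<pi>
    = (\<Sum>h\<in>profile_set n m P. guesswork_random_strategy n M b h) / real (card (profile_set n m P))"
proof -
  let ?V = "password_vectors n M" and ?H = "profile_set n m P" and ?Q = "strategies n"
  let ?f = "\<lambda>\<pi>. \<Sum>(g, h)\<in>?V \<times> ?H. remote_average n M b g h \<pi>"
  have perm: "\<sigma> permutes inputs n \<longleftrightarrow> \<sigma> \<in> ?Q" for \<sigma> by (simp add: strategies_def)
  have inv: "?f (inv \<sigma> \<circ> \<pi>) = ?f \<pi>" if \<sigma>: "\<sigma> permutes inputs n" for \<sigma>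
  proof -
    have "bij_betw (\<lambda>(g, h). (\<sigma> \<circ> g, h \<circ> inv \<sigma>)) (?V \<times> ?H) (?V \<times> ?H)"
    proof (rule bij_betwI[where g = "\<lambda>(g, h). (inv \<sigma> \<circ> g, h \<circ> \<sigma>)"])
      show "(\<lambda>(g, h). (\<sigma> \<circ> g, h \<circ> inv \<sigma>)) \<in> ?V \<times> ?H \<rightarrow> ?V \<times> ?H"
        by (auto intro!: password_vectors_comp[OF \<sigma>] profile_set_comp[OF permutes_inv[OF \<sigma>]])
      show "(\<lambda>(g, h). (inv \<sigma> \<circ> g, h \<circ> \<sigma>)) \<in> ?V \<times> ?H \<rightarrow> ?V \<times> ?H"
        by (auto intro!: password_vectors_comp[OF permutes_inv[OF \<sigma>]] profile_set_comp[OF \<sigma>])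
    qed (auto simp: o_def permutes_inverses[OF \<sigma>])
    from sum.reindex_bij_betw[OF this, of "\<lambda>(g, h). remote_average n M b g h \<pi>"]
    show ?thesis by (simp add: case_prod_beta' remote_average_relabel[OF \<sigma>])
  qed
  \<comment> \<open>A sum of equal terms; inversion and right composition with \<open>\<pi>\<close>
    then turn it into a sum over all strategies.\<close>
  have "real (card ?Q) * ?f \<pi> = (\<Sum>\<sigma>\<in>?Q. ?f (inv \<sigma> \<circ> \<pi>))"
    by (simp add: inv perm)
  also have "\<dots> = (\<Sum>\<sigma>\<in>?Q. ?f (\<sigma> \<circ> \<pi>))"
    unfolding strategies_def by (rule sum_permutations_inverse[symmetric])
  also have "\<dots> = (\<Sum>\<sigma>\<in>?Q. ?f \<sigma>)"
    using \<pi> unfolding strategies_def by (intro sum_permutations_compose_right[symmetric]) auto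
  also have "\<dots> = (\<Sum>h\<in>?H. \<Sum>g\<in>?V. \<Sum>\<sigma>\<in>?Q. remote_average n M b g h \<sigma>)"
    by (simp add: sum.cartesian_product[symmetric] sum.swap[of _ _ ?Q] sum.swap[of _ ?V ?H])
  also have "\<dots> = (\<Sum>h\<in>?H. guesswork_random_strategy n M b h) * (real (card ?V) * real (card ?Q))"
    by (simp add: guesswork_random_strategy_eq_sum sum_divide_distrib[symmetric] card_gt_0_iff)
  finally have "?f \<pi> = (\<Sum>h\<in>?H. guesswork_random_strategy n M b h) * real (card ?V)"
    by simp
  moreover have "guesswork_random_hash n m P M b \<pi> = ?f \<pi> / (real (card ?V) * real (card ?H))"
    unfolding guesswork_random_hash_def passwords_eq using ne
    by (simp add: pair_pmf_of_set integral_pmf_of_set card_cartesian_product)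
  ultimately show ?thesis by simp
qed

lemma guesswork_random_hash_bounds:
  assumes "profile_set n m P \<noteq> {}" "\<pi> \<in> strategies n"
    and lo: "\<And>h. h \<in> profile_set n m P \<Longrightarrow> l \<le> guesswork_random_strategy n M b h"
    and up: "\<And>h. h \<in> profile_set n m P \<Longrightarrow> guesswork_random_strategy n M b h \<le> u"
  shows "l \<le> guesswork_random_hash n m P M b \<pi>" "guesswork_random_hash n m P M b \<pi> \<le> u"
proof -
  let ?H = "profile_set n m P"
  have c: "0 < real (card ?H)" using assms(1) by (simp add: card_gt_0_iff)
  have "real (card ?H) * l \<le> (\<Sum>h\<in>?H. guesswork_random_strategy n M b h)"
    using sum_bounded_below[of ?H l] lo by simp
  then show "l \<le> guesswork_random_hash n m P M b \<pi>"
    using c by (simp add: guesswork_random_hash_eq_average[OF assms(1,2)] field_simps)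
  have "(\<Sum>h\<in>?H. guesswork_random_strategy n M b h) \<le> real (card ?H) * u"
    using sum_bounded_above[of ?H _ u] up by simp
  then show "guesswork_random_hash n m P M b \<pi> \<le> u"
    using c by (simp add: guesswork_random_hash_eq_average[OF assms(1,2)] field_simps)
qed

subsection \<open>Types and entropy\<close>

text \<open>Up to normalisation \<open>a ^ b / fact b\<close> is the Poisson weight of mean
  \<open>a\<close>. It is largest at \<open>b = a\<close>, because the ratio
  \<open>a / (b + 1)\<close> of consecutive weights is at least \<open>1\<close> exactly for
  \<open>b < a\<close>. The two cases are inductions down and up from \<open>a\<close>.\<close>

lemma fact_power_mode: "a ^ b * fact a \<le> a ^ a * (fact b :: nat)"
proof (cases "b \<le> a")
  case True
  have "fact a \<le> a ^ (a - b) * (fact b :: nat)"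
    using True
  proof (induction rule: inc_induct)
    case (step i)
    have "fact a \<le> a ^ (a - Suc i) * (fact (Suc i) :: nat)" by (rule step.IH)
    also have "\<dots> = a ^ (a - Suc i) * (Suc i * fact i)" by simp
    also have "\<dots> \<le> a ^ (a - Suc i) * (a * fact i)"
      using step.hyps by (intro mult_left_mono mult_right_mono) auto
    also have "\<dots> = a ^ Suc (a - Suc i) * fact i" by simp
    also have "Suc (a - Suc i) = a - i" using step.hyps by simp
    finally show ?case .
  qed simp
  then have "a ^ b * fact a \<le> a ^ b * (a ^ (a - b) * (fact b :: nat))" by (rule mult_left_mono) simp
  also have "\<dots> = a ^ a * fact b" using True by (simp add: mult.assoc[symmetric] power_add[symmetric])
  finally show ?thesis .
next
  case False
  then have "a \<le> b" by simp
  then show ?thesis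
  proof (induction rule: dec_induct)
    case (step i)
    have "a ^ Suc i * fact a = a * (a ^ i * fact a)" by simp
    also have "\<dots> \<le> Suc i * (a ^ a * fact i)"
      using step.hyps by (intro mult_mono[OF _ step.IH]) auto
    finally show ?case by (simp add: algebra_simps)
  qed simp
qed

text \<open>The binomial distribution with success probability \<open>k / m\<close> has its mode at
  \<open>k\<close>. Multiplying by the factorials splits this into two instances of
  \<open>fact_power_mode\<close>.\<close>

lemma binomial_mode:
  assumes "j \<le> m" "k \<le> m"
  shows "(m choose j) * (k ^ j * (m - k) ^ (m - j)) \<le> (m choose k) * (k ^ k * (m - k) ^ (m - k))"
proof -
  let ?c = "fact j * fact (m - j) * (fact k * fact (m - k)) :: nat"
  have "?c * ((m choose j) * (k ^ j * (m - k) ^ (m - j)))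
    = (fact j * fact (m - j) * (m choose j)) * ((k ^ j * fact k) * ((m - k) ^ (m - j) * fact (m - k)))"
    by (simp add: algebra_simps)
  also have "\<dots> = fact m * ((k ^ j * fact k) * ((m - k) ^ (m - j) * fact (m - k)))"
    by (simp only: binomial_fact_lemma[OF assms(1)])
  also have "\<dots> \<le> fact m * ((k ^ k * fact j) * ((m - k) ^ (m - k) * fact (m - j)))"
    by (intro mult_left_mono mult_mono fact_power_mode) auto
  also have "\<dots> = (fact k * fact (m - k) * (m choose k)) * ((k ^ k * fact j) * ((m - k) ^ (m - k) * fact (m - j)))"
    by (simp only: binomial_fact_lemma[OF assms(2)])
  also have "\<dots> = ?c * ((m choose k) * (k ^ k * (m - k) ^ (m - k)))"
    by (simp add: algebra_simps)
  finally show ?thesis by simp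
qed

text \<open>The \<open>m + 1\<close> weights of the binomial distribution with parameter
  \<open>k / m\<close> add up to \<open>1\<close>, so the largest one, at \<open>k\<close>, is at
  least \<open>1 / (m + 1)\<close>. Its power factor is \<open>2\<close> to the exponent
  \<open>- m\<close> times the entropy.\<close>

lemma log_binomial_ge:
  assumes k: "0 < k" "k \<le> m"
  shows "log 2 (real (m choose k)) \<ge> real m * binary_entropy (real k / real m) - log 2 (real m + 1)"
proof (cases "k = m")
  case True
  then show ?thesis using k by (simp add: binary_entropy_def)
next
  case False
  then have km: "k < m" using k by simp
  define q where "q = real k / real m"
  have q: "0 < q" "q < 1" and q': "1 - q = real (m - k) / real m"
    using k km by (auto simp: q_def field_simps)
  let ?r = "q ^ k * (1 - q) ^ (m - k)"
  \<comment> \<open>Over the common denominator \<open>m ^ m\<close> the integer inequality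
    \<open>binomial_mode\<close> becomes applicable.\<close>
  have scale: "q ^ j * (1 - q) ^ (m - j) = real (k ^ j * (m - k) ^ (m - j)) / real m ^ m"
    if "j \<le> m" for j
    using that k unfolding q' unfolding q_def
    by (simp add: power_divide power_add[symmetric])
  have "1 = (q + (1 - q)) ^ m" by simp
  also have "\<dots> = (\<Sum>j\<le>m. real (m choose j) * (q ^ j * (1 - q) ^ (m - j)))"
    by (subst binomial_ring) (simp add: mult.assoc)
  also have "\<dots> \<le> (\<Sum>j\<le>m. real (m choose k) * ?r)"
  proof (rule sum_mono)
    fix j assume "j \<in> {..m}"
    then have j: "j \<le> m" by simp
    have "real ((m choose j) * (k ^ j * (m - k) ^ (m - j)))
        \<le> real ((m choose k) * (k ^ k * (m - k) ^ (m - k)))"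
      using binomial_mode[OF j k(2)] by (rule of_nat_mono)
    then show "real (m choose j) * (q ^ j * (1 - q) ^ (m - j)) \<le> real (m choose k) * ?r"
      unfolding scale[OF j] scale[OF k(2)] of_nat_mult times_divide_eq_right
      by (intro divide_right_mono) auto
  qed
  finally have ge: "1 \<le> (real m + 1) * (real (m choose k) * ?r)" by (simp add: algebra_simps)
  have C: "0 < real (m choose k)" using k by simp
  have "log 2 ?r = - (real m * binary_entropy q)"
  proof -
    have "log 2 ?r = real k * log 2 q + real (m - k) * log 2 (1 - q)"
      using q by (simp add: log_mult log_nat_power)
    moreover have "real k = real m * q" "real (m - k) = real m * (1 - q)"
      using k q' by (simp_all add: q_def)
    ultimately show ?thesis by (simp add: binary_entropy_def algebra_simps)
  qed
  moreover have "0 \<le> log 2 (real m + 1) + (log 2 (real (m choose k)) + log 2 ?r)"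
  proof -
    have "0 \<le> log 2 ((real m + 1) * (real (m choose k) * ?r))" using ge by (subst zero_le_log_cancel_iff) auto
    also have "\<dots> = log 2 (real m + 1) + (log 2 (real (m choose k)) + log 2 ?r)"
      using q C by (subst log_mult_pos; simp add: log_mult_pos)
    finally show ?thesis .
  qed
  ultimately show ?thesis by (simp add: q_def)
qed

section \<open>Sums over binary strings and sizes of type classes\<close>

lemma bins_Suc: "bins (Suc m) = (#) True ` bins m \<union> (#) False ` bins m"
proof (intro equalityI subsetI)
  fix b :: "bool list" assume "b \<in> bins (Suc m)"
  then obtain x c where "b = x # c" "c \<in> bins m" by (auto simp: bins_def length_Suc_conv)
  then show "b \<in> (#) True ` bins m \<union> (#) False ` bins m" by (cases x) auto
qed (auto simp: bins_def)

lemma finite_bins [simp]: "finite (bins m)"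
proof (induction m)
  case 0
  have "bins 0 = {[]}" by (auto simp: bins_def)
  then show ?case by simp
qed (simp add: bins_Suc)

text \<open>The binomial theorem before grouping by type. It serves both for Bernoulli weights,
  where \<open>x + y = 1\<close>, and for inverse Bernoulli probabilities.\<close>

lemma sum_bins_power:
  fixes x y :: real
  shows "(\<Sum>b\<in>bins m. x ^ count_list b True * y ^ count_list b False) = (x + y) ^ m"
proof (induction m)
  case 0
  have "bins 0 = {[]}" by (auto simp: bins_def)
  then show ?case by simp
next
  case (Suc m)
  have "(\<Sum>b\<in>bins (Suc m). x ^ count_list b True * y ^ count_list b False)
    = (\<Sum>b\<in>bins m. x * (x ^ count_list b True * y ^ count_list b False))
      + (\<Sum>b\<in>bins m. y * (x ^ count_list b True * y ^ count_list b False))"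
    unfolding bins_Suc by (subst sum.union_disjoint) (auto simp: sum.reindex algebra_simps)
  also have "\<dots> = (x + y) * (x + y) ^ m"
    unfolding sum_distrib_left[symmetric] Suc by (simp add: algebra_simps)
  finally show ?case by simp
qed

lemma card_type_class: "card {b \<in> bins m. count_list b True = k} = m choose k"
proof (induction m arbitrary: k)
  case 0
  have "{b \<in> bins 0. count_list b True = k} = (if k = 0 then {[]} else {})" by (auto simp: bins_def)
  then show ?case by simp
next
  case (Suc m)
  have F: "card ((#) False ` {b \<in> bins m. count_list b True = k}) = m choose k" for k
    by (subst card_image) (simp_all add: Suc)
  have T: "card ((#) True ` {b \<in> bins m. count_list b True = k}) = m choose k" for k
    by (subst card_image) (simp_all add: Suc)
  show ?case
  proof (cases k)
    case 0
    have "{b \<in> bins (Suc m). count_list b True = k} = (#) False ` {b \<in> bins m. count_list b True = 0}"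
      by (auto simp: bins_Suc 0)
    then show ?thesis using F[of 0] 0 by simp
  next
    case (Suc l)
    have "{b \<in> bins (Suc m). count_list b True = k}
      = (#) True ` {b \<in> bins m. count_list b True = l} \<union> (#) False ` {b \<in> bins m. count_list b True = k}"
      by (auto simp: bins_Suc Suc)
    also have "card \<dots> = (m choose l) + (m choose k)"
      by (subst card_Un_disjoint) (auto simp: T F)
    finally show ?thesis using Suc by simp
  qed
qed

lemma count_True_False: "count_list b True + count_list b False = length b"
  by (induction b) auto

section \<open>Entropy inequalities\<close>

text \<open>The cross entropy of Bernoulli(\<open>q\<close>) relative to
  Bernoulli(\<open>p\<close>). It is affine in \<open>q\<close>, so exponents can be compared by
  their slopes.\<close>

definition cross_entropy :: "real \<Rightarrow> real \<Rightarrow> real" where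
  "cross_entropy q p = - q * log 2 p - (1 - q) * log 2 (1 - p)"

lemma entropy_plus_divergence:
  assumes "0 < p" "p < 1" "0 \<le> q" "q \<le> 1"
  shows "binary_entropy q + binary_divergence q p = cross_entropy q p"
proof -
  have "q * log 2 (q / p) = q * log 2 q - q * log 2 p"
    using assms by (cases "q = 0") (auto simp: log_divide algebra_simps)
  moreover have "(1 - q) * log 2 ((1 - q) / (1 - p)) = (1 - q) * log 2 (1 - q) - (1 - q) * log 2 (1 - p)"
    using assms by (cases "q = 1") (auto simp: log_divide algebra_simps)
  ultimately show ?thesis
    by (simp add: binary_entropy_def binary_divergence_def cross_entropy_def)
qed

text \<open>Gibbs' inequality, obtained termwise from \<open>ln x \<le> x - 1\<close>.\<close>

lemma binary_entropy_le_cross_entropy: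
  assumes "0 \<le> q" "q \<le> 1" "0 < r" "r < 1"
  shows "binary_entropy q \<le> cross_entropy q r"
proof -
  have *: "x * log 2 y - x * log 2 x \<le> (y - x) / ln 2" if "0 \<le> x" "0 < y" for x y :: real
  proof (cases "x = 0")
    case True
    then show ?thesis using that by simp
  next
    case False
    then have x: "0 < x" using that by simp
    have "x * ln (y / x) \<le> x * (y / x - 1)"
      using x that by (intro mult_left_mono ln_le_minus_one) auto
    also have "\<dots> = y - x" using x by (simp add: algebra_simps)
    finally have "x * (ln y - ln x) \<le> y - x" using x that by (simp add: ln_div)
    then have "x * (ln y - ln x) / ln 2 \<le> (y - x) / ln 2" by (intro divide_right_mono) auto
    then show ?thesis by (simp add: log_def right_diff_distrib diff_divide_distrib)
  qed
  have "q * log 2 r - q * log 2 q + ((1 - q) * log 2 (1 - r) - (1 - q) * log 2 (1 - q))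
    \<le> (r - q) / ln 2 + ((1 - r) - (1 - q)) / ln 2"
    by (intro add_mono *) (use assms in auto)
  also have "\<dots> = 0" by (simp add: add_divide_distrib[symmetric])
  finally show ?thesis by (simp add: binary_entropy_def cross_entropy_def)
qed

lemma binary_entropy_le_1:
  assumes "0 \<le> q" "q \<le> 1"
  shows "binary_entropy q \<le> 1"
  using binary_entropy_le_cross_entropy[OF assms, of "1 / 2"]
  by (simp add: cross_entropy_def log_divide)

lemma binary_entropy_nonneg:
  assumes "0 \<le> q" "q \<le> 1"
  shows "0 \<le> binary_entropy q"
proof -
  have "x * log 2 x \<le> 0" if "0 \<le> x" "x \<le> 1" for x :: real
    using that by (cases "x = 0") (auto simp: mult_le_0_iff)
  from this[of q] this[of "1 - q"] show ?thesis using assms by (simp add: binary_entropy_def)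
qed

text \<open>As a function of \<open>t\<close>, \<open>cross_entropy t s\<close> is the tangent to
  the entropy at \<open>s\<close>. By Gibbs' inequality it lies above the entropy, and its slope is
  nonpositive for \<open>1 / 2 \<le> s\<close>.\<close>

lemma binary_entropy_antimono:
  assumes "1 / 2 \<le> s" "s \<le> t" "t \<le> 1"
  shows "binary_entropy t \<le> binary_entropy s"
proof (cases "s = 1")
  case True
  then show ?thesis using assms by simp
next
  case False
  then have s: "0 < s" "s < 1" using assms by auto
  have "binary_entropy t \<le> cross_entropy t s"
    using assms s by (intro binary_entropy_le_cross_entropy) auto
  also have "\<dots> \<le> cross_entropy s s"
  proof -
    have "0 \<le> (t - s) * (log 2 s - log 2 (1 - s))"
      using assms s by (intro mult_nonneg_nonneg) auto
    then show ?thesis by (simp add: cross_entropy_def algebra_simps)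
  qed
  finally show ?thesis by (simp add: cross_entropy_def binary_entropy_def)
qed

text \<open>The exponent is a cross entropy, hence linear in the numbers of ones and zeros: the
  type-class profile is the law of i.i.d. Bernoulli(\<open>p\<close>) bits.\<close>

lemma type_profile_powr:
  assumes "0 < p" "p < 1" and b: "b \<in> bins m" and m: "1 \<le> m"
  shows "type_profile p b
    = 2 powr (real (count_list b True) * log 2 p + real (count_list b False) * log 2 (1 - p))"
proof -
  have len: "length b = m" using b by (simp add: bins_def)
  have le: "count_list b True \<le> m" using count_True_False[of b] len by simp
  have F: "real (count_list b False) = real m - real (count_list b True)"
    using count_True_False[of b] len by linarith
  have "bin_type b = real (count_list b True) / real m" by (simp add: bin_type_def len)
  then have q: "0 \<le> bin_type b" "bin_type b \<le> 1" and T: "real (count_list b True) = real m * bin_type b"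
    using le m by (auto simp: divide_le_eq)
  show ?thesis
    unfolding type_profile_def entropy_plus_divergence[OF assms(1,2) q] cross_entropy_def len F
    unfolding T by (simp add: algebra_simps)
qed

lemma type_profile_eq:
  assumes "0 < p" "p < 1" "b \<in> bins m" "1 \<le> m"
  shows "type_profile p b = p ^ count_list b True * (1 - p) ^ count_list b False"
  using assms
  by (simp add: type_profile_powr[OF assms] powr_add powr_powr[symmetric] mult.commute[of "real _"] powr_realpow)

text \<open>Either every allocated bin has probability at most \<open>v\<close>, or
  \<open>b M\<close> is more likely than \<open>v\<close>, and then monotonicity puts all of
  \<open>T\<close> among the allocated bins.\<close>

lemma sum_least_likely_ge:
  assumes b: "bin_order m P b" and pos: "\<And>c. c \<in> bins m \<Longrightarrow> 0 < P c" and M: "1 \<le> M" "M \<le> 2 ^ m"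
    and T: "T \<subseteq> bins m" "\<And>c. c \<in> T \<Longrightarrow> P c = v" and v: "0 < v"
  shows "min (real M) (real (card T)) / v \<le> (\<Sum>i = 1..M. 1 / P (b i))"
proof -
  have bb: "bij_betw b {1..2 ^ m} (bins m)" and mono: "mono_on {1..2 ^ m} (\<lambda>i. P (b i))"
    using b by (auto simp: bin_order_def)
  have le: "P (b i) \<le> P (b j)" if "1 \<le> i" "i \<le> j" "j \<le> 2 ^ m" for i j
    using mono that by (auto simp: mono_on_def)
  have bin: "b i \<in> bins m" if "1 \<le> i" "i \<le> 2 ^ m" for i using bb that by (auto simp: bij_betw_def)
  show ?thesis
  proof (cases "P (b M) \<le> v")
    case True
    have "real M / v = (\<Sum>i = 1..M. 1 / v)" by simp
    also have "\<dots> \<le> (\<Sum>i = 1..M. 1 / P (b i))"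
    proof (intro sum_mono divide_left_mono)
      fix i assume "i \<in> {1..M}"
      then have i: "1 \<le> i" "i \<le> M" by auto
      show "P (b i) \<le> v" using le[OF i M(2)] True by simp
      show "0 < v * P (b i)" using v pos bin i M by simp
    qed auto
    finally show ?thesis using v by (simp add: min_def divide_right_mono order_trans[rotated])
  next
    case False
    define I where "I = {i \<in> {1..2 ^ m}. b i \<in> T}"
    have "T \<subseteq> b ` {1..2 ^ m}" using bb T(1) by (simp add: bij_betw_def)
    then have "b ` I = T" by (auto simp: I_def)
    moreover have "inj_on b I"
      using bij_betw_imp_inj_on[OF bb] by (rule inj_on_subset) (auto simp: I_def)
    ultimately have card: "card I = card T" using card_image[of b I] by simp
    have sub: "I \<subseteq> {1..M}"
    proof
      fix i assume i: "i \<in> I"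
      have "\<not> M \<le> i"
      proof
        assume "M \<le> i"
        then have "P (b M) \<le> P (b i)" using le i M by (auto simp: I_def)
        then show False using False T(2) i by (simp add: I_def)
      qed
      then show "i \<in> {1..M}" using i by (auto simp: I_def)
    qed
    have "real (card T) / v = (\<Sum>i\<in>I. 1 / P (b i))"
      using T(2) by (simp add: I_def card[symmetric])
    also have "\<dots> \<le> (\<Sum>i = 1..M. 1 / P (b i))"
      using sub pos bin M by (intro sum_mono2) (auto intro: less_imp_le)
    finally show ?thesis using v by (simp add: min_def divide_right_mono order_trans[rotated])
  qed
qed

subsection \<open>The average over the least likely bins\<close>

lemma num_users_bounds:
  assumes s: "0 \<le> s" "s \<le> 1"
  shows "1 \<le> num_users s m" "real (num_users s m) \<le> 2 powr (real m * binary_entropy s)"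
    "2 powr (real m * binary_entropy s) / 4 \<le> real (num_users s m)" "num_users s m \<le> 2 ^ m"
proof -
  define x where "x = 2 powr (binary_entropy s * real m - 1)"
  have x: "2 powr (real m * binary_entropy s) = 2 * x"
    by (simp add: x_def powr_diff mult.commute)
  have M: "num_users s m = max 1 (nat \<lfloor>x\<rfloor>)" by (simp add: num_users_def x_def)
  have x0: "0 < x" by (simp add: x_def)
  have ge1: "1 \<le> 2 powr (real m * binary_entropy s)"
    using binary_entropy_nonneg[OF s] by (intro ge_one_powr_ge_zero) auto
  show "1 \<le> num_users s m" by (simp add: M)
  have fl: "real (nat \<lfloor>x\<rfloor>) \<le> x" "x - 1 \<le> real (nat \<lfloor>x\<rfloor>)" using x0 by linarith+
  show le: "real (num_users s m) \<le> 2 powr (real m * binary_entropy s)"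
    using fl(1) x0 ge1 x unfolding M of_nat_max by linarith
  \<comment> \<open>The claim is \<open>x / 2 \<le> max 1 (x - 1)\<close>: for
    \<open>x \<le> 2\<close> the \<open>1\<close> suffices, beyond that \<open>x - 1\<close>
    does.\<close>
  show "2 powr (real m * binary_entropy s) / 4 \<le> real (num_users s m)"
    using fl(2) unfolding x M of_nat_max by linarith
  have "2 powr (real m * binary_entropy s) \<le> 2 powr real m"
    using binary_entropy_le_1[OF s] by (intro powr_mono) (auto simp: mult_left_le)
  with le have "real (num_users s m) \<le> 2 powr real m" by (rule order_trans)
  then have "real (num_users s m) \<le> 2 ^ m" by (simp add: powr_realpow)
  then show "num_users s m \<le> 2 ^ m"
    using of_nat_le_iff[of "num_users s m" "2 ^ m", where 'a = real] by simp
qed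

lemma type_profile_pos: "0 < type_profile p b"
  by (simp add: type_profile_def)

definition rate :: "real \<Rightarrow> real \<Rightarrow> real" where
  "rate p s = (if 1 - p \<le> s then binary_entropy s + binary_divergence s p
    else 2 * binary_entropy p + binary_divergence (1 - p) p - binary_entropy s)"

text \<open>Users of type \<open>t\<close> make up, on the exponential scale, the fraction
  \<open>2 powr (m * (binary_entropy t - binary_entropy s))\<close> of all users and dominate the average for this value of \<open>t\<close>.\<close>

lemma rate_eq:
  fixes p s :: real
  assumes p: "0 < p" "p \<le> 1 / 2" and s: "1 / 2 \<le> s" "s \<le> 1"
  defines "t \<equiv> max s (1 - p)"
  shows "rate p s = binary_entropy t - binary_entropy s + cross_entropy t p"
proof (cases "1 - p \<le> s")
  case True
  then show ?thesis using assms by (simp add: rate_def entropy_plus_divergence)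
next
  case False
  have "binary_entropy (1 - p) = binary_entropy p" by (simp add: binary_entropy_def algebra_simps)
  moreover have "binary_entropy (1 - p) + binary_divergence (1 - p) p = cross_entropy (1 - p) p"
    using p by (intro entropy_plus_divergence) auto
  ultimately show ?thesis using False by (simp add: rate_def t_def max_def)
qed

section \<open>Upper bound for the average\<close>

text \<open>Over all bins the sum factorises with base
  \<open>1 / p + 1 / (1 - p) = 1 / (p * (1 - p))\<close>. Its dominant type is \<open>1 - p\<close>,
  so this crude bound has the right exponent when \<open>s < 1 - p\<close>.\<close>

lemma sum_inverse_type_profile_le:
  assumes p: "0 < p" "p < 1" and B: "B \<subseteq> bins m" and m: "1 \<le> m"
  shows "(\<Sum>c\<in>B. 1 / type_profile p c) \<le> 2 powr (- real m * (log 2 p + log 2 (1 - p)))"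
proof -
  have "(\<Sum>c\<in>B. 1 / type_profile p c) \<le> (\<Sum>c\<in>bins m. 1 / type_profile p c)"
    using B by (intro sum_mono2) (auto intro: less_imp_le type_profile_pos)
  also have "\<dots> = (\<Sum>c\<in>bins m. (1 / p) ^ count_list c True * (1 / (1 - p)) ^ count_list c False)"
    by (intro sum.cong refl) (simp add: type_profile_eq[OF p _ m] power_one_over)
  also have "\<dots> = (1 / (p * (1 - p))) ^ m"
    using p by (subst sum_bins_power) (simp add: field_simps)
  also have "\<dots> = (2 powr (log 2 (1 / (p * (1 - p))))) ^ m"
    using p by (subst powr_log_cancel) auto
  also have "\<dots> = 2 powr (- real m * (log 2 p + log 2 (1 - p)))"
    using p by (simp add: powr_realpow[symmetric] powr_powr log_divide log_mult_pos) (simp add: algebra_simps)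
  finally show ?thesis .
qed

text \<open>A Chernoff-type bound: bins of type above \<open>s\<close> are charged to their probability under
  Bernoulli(\<open>s\<close>) bits.\<close>

lemma inverse_type_profile_le:
  assumes p: "0 < p" "p \<le> 1 / 2" and s: "1 - p \<le> s" "s < 1" and c: "c \<in> bins m" and m: "1 \<le> m"
  shows "1 / type_profile p c \<le> 2 powr (real m * cross_entropy s p)
    + 2 powr (real m * (binary_entropy s + cross_entropy s p))
      * (s ^ count_list c True * (1 - s) ^ count_list c False)"
proof -
  define k where "k = real (count_list c True)"
  define l where "l = real (count_list c False)"
  have kl: "l = real m - k" using count_True_False[of c] c unfolding k_def l_def bins_def by force
  define \<alpha> where "\<alpha> = log 2 p"
  define \<beta> where "\<beta> = log 2 (1 - p)"
  define \<gamma> where "\<gamma> = log 2 s"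
  define \<delta> where "\<delta> = log 2 (1 - s)"
  have s0: "0 < s" "0 < 1 - s" using p s by auto
  have ab: "\<alpha> \<le> \<beta>" using p by (simp add: \<alpha>_def \<beta>_def)
  have gd: "\<beta> \<le> \<gamma>" "\<delta> \<le> \<alpha>" using p s s0 by (auto simp: \<alpha>_def \<beta>_def \<gamma>_def \<delta>_def)
  have inv: "1 / type_profile p c = 2 powr (- (k * \<alpha> + l * \<beta>))"
    using p unfolding powr_minus_divide
    by (simp add: type_profile_powr[OF _ _ c m] k_def l_def \<alpha>_def \<beta>_def)
  have bern: "s ^ count_list c True * (1 - s) ^ count_list c False = 2 powr (k * \<gamma> + l * \<delta>)"
    using type_profile_powr[OF _ _ c m, of s] type_profile_eq[OF _ _ c m, of s] s0
    by (simp add: k_def l_def \<gamma>_def \<delta>_def)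
  have ce: "cross_entropy s p = - s * \<alpha> - (1 - s) * \<beta>" by (simp add: cross_entropy_def \<alpha>_def \<beta>_def)
  have be: "binary_entropy s = - s * \<gamma> - (1 - s) * \<delta>" by (simp add: binary_entropy_def \<gamma>_def \<delta>_def)
  show ?thesis
  proof (cases "k \<le> s * real m")
    case True
    \<comment> \<open>The exponent of the inverse profile has slope
      \<open>\<beta> - \<alpha> \<ge> 0\<close> in \<open>k\<close>, so its value at
      \<open>k = s * m\<close> bounds it.\<close>
    have "0 \<le> (s * real m - k) * (\<beta> - \<alpha>)" using True ab by simp
    then have "- (k * \<alpha> + l * \<beta>) \<le> real m * cross_entropy s p"
      unfolding ce kl by (simp add: algebra_simps)
    then have "1 / type_profile p c \<le> 2 powr (real m * cross_entropy s p)"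
      unfolding inv by (intro powr_mono) auto
    moreover have "0 \<le> 2 powr (real m * (binary_entropy s + cross_entropy s p))
      * (s ^ count_list c True * (1 - s) ^ count_list c False)" using s0 by simp
    ultimately show ?thesis by linarith
  next
    case False
    \<comment> \<open>Both exponents are affine in \<open>k\<close> and agree at
      \<open>k = s * m\<close>. Beyond that point the Bernoulli side grows at least as fast, since
      \<open>1 - p \<le> s\<close> gives
      \<open>\<beta> - \<alpha> \<le> \<gamma> - \<delta>\<close>.\<close>
    have "0 \<le> (k - s * real m) * ((\<gamma> - \<delta>) - (\<beta> - \<alpha>))" using False gd by simp
    then have "- (k * \<alpha> + l * \<beta>)
      \<le> real m * (binary_entropy s + cross_entropy s p) + (k * \<gamma> + l * \<delta>)"
      unfolding ce be kl by (simp add: algebra_simps)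
    then have "1 / type_profile p c \<le> 2 powr (real m * (binary_entropy s + cross_entropy s p))
      * 2 powr (k * \<gamma> + l * \<delta>)"
      unfolding inv powr_add[symmetric] by (intro powr_mono) auto
    moreover have "0 \<le> 2 powr (real m * cross_entropy s p)" by simp
    ultimately show ?thesis unfolding bern by linarith
  qed
qed

text \<open>Below \<open>1 - p\<close> the sum over all bins is good enough; from
  \<open>1 - p\<close> on the Chernoff bound is used, except at \<open>s = 1\<close>, where each
  term is at most \<open>p\<close> to the power \<open>- m\<close>. The factor \<open>5\<close> is
  \<open>1 + 4\<close>, the \<open>4\<close> coming from replacing
  \<open>2 powr (m * binary_entropy s)\<close> by \<open>M\<close>.\<close>

lemma average_inverse_le:
  fixes p s :: real
  assumes p: "0 < p" "p \<le> 1 / 2" and s: "1 / 2 \<le> s" "s \<le> 1" and m: "1 \<le> m"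
    and b: "inj_on b {1..num_users s m}" "b ` {1..num_users s m} \<subseteq> bins m"
  shows "(\<Sum>i = 1..num_users s m. 1 / type_profile p (b i)) / real (num_users s m)
    \<le> 5 * 2 powr (real m * rate p s)"
proof -
  define M where "M = num_users s m"
  define B where "B = b ` {1..M}"
  have M: "1 \<le> M" "2 powr (real m * binary_entropy s) / 4 \<le> real M"
    using num_users_bounds[of s m] s by (auto simp: M_def)
  have B: "B \<subseteq> bins m" "card B = M" using b by (auto simp: B_def M_def card_image)
  have sum: "(\<Sum>i = 1..M. 1 / type_profile p (b i)) = (\<Sum>c\<in>B. 1 / type_profile p c)"
    using b(1) unfolding B_def M_def by (simp add: sum.reindex)
  have quarter: "2 powr (real m * x) \<le> 4 * (2 powr (real m * (x - binary_entropy s)) * real M)" for x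
  proof -
    have "2 powr (real m * x) = 2 powr (real m * (x - binary_entropy s)) * 2 powr (real m * binary_entropy s)"
      by (simp add: powr_add[symmetric] algebra_simps)
    also have "\<dots> \<le> 2 powr (real m * (x - binary_entropy s)) * (4 * real M)"
      using M by (intro mult_left_mono) auto
    finally show ?thesis by simp
  qed
  have r: "rate p s = binary_entropy (max s (1 - p)) - binary_entropy s + cross_entropy (max s (1 - p)) p"
    by (rule rate_eq[OF p s])
  have "(\<Sum>c\<in>B. 1 / type_profile p c) \<le> 5 * 2 powr (real m * rate p s) * real M"
  proof -
    consider "s < 1 - p" | "1 - p \<le> s" "s < 1" | "s = 1" using s by linarith
    then show ?thesis
    proof cases
      case 1
      have "(\<Sum>c\<in>B. 1 / type_profile p c) \<le> 2 powr (real m * (- (log 2 p + log 2 (1 - p))))"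
        using sum_inverse_type_profile_le[OF _ _ B(1) m, of p] p by (simp add: algebra_simps)
      also have "\<dots> \<le> 4 * (2 powr (real m * (- (log 2 p + log 2 (1 - p)) - binary_entropy s)) * real M)"
        by (rule quarter)
      \<comment> \<open>For type \<open>1 - p\<close>, entropy and cross entropy relative to
        \<open>p\<close> add up to \<open>- log 2 p - log 2 (1 - p)\<close>.\<close>
      also have "- (log 2 p + log 2 (1 - p)) - binary_entropy s = rate p s"
        unfolding r using 1 by (simp add: max_def cross_entropy_def binary_entropy_def algebra_simps)
      finally show ?thesis by (rule order_trans) (simp add: mult_right_mono)
    next
      case 2
      have rr: "rate p s = cross_entropy s p" unfolding r using 2 by (simp add: max_def)
      let ?w = "\<lambda>c. s ^ count_list c True * (1 - s) ^ count_list c False"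
      let ?H = "2 powr (real m * (binary_entropy s + cross_entropy s p))"
      have "(\<Sum>c\<in>B. 1 / type_profile p c) \<le> (\<Sum>c\<in>B. 2 powr (real m * cross_entropy s p) + ?H * ?w c)"
        using inverse_type_profile_le[OF p 2 _ m] B(1) by (intro sum_mono) blast
      also have "\<dots> = real M * 2 powr (real m * cross_entropy s p) + ?H * (\<Sum>c\<in>B. ?w c)"
        by (simp add: sum.distrib sum_distrib_left B(2))
      also have "(\<Sum>c\<in>B. ?w c) \<le> (\<Sum>c\<in>bins m. ?w c)"
        using B(1) s by (intro sum_mono2) auto
      also have "(\<Sum>c\<in>bins m. ?w c) = 1" by (simp add: sum_bins_power)
      also have "?H * 1 \<le> 4 * (2 powr (real m * cross_entropy s p) * real M)"
        using quarter[of "binary_entropy s + cross_entropy s p"] by simp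
      finally show ?thesis by (simp add: rr algebra_simps)
    next
      case 3
      have rr: "rate p s = - log 2 p" unfolding r using 3 p by (simp add: max_def cross_entropy_def)
      have "(\<Sum>c\<in>B. 1 / type_profile p c) \<le> (\<Sum>c\<in>B. 2 powr (real m * rate p s))"
      proof (rule sum_mono)
        fix c assume "c \<in> B"
        then have c: "c \<in> bins m" using B by auto
        have l: "real m = real (count_list c True) + real (count_list c False)"
          using count_True_False[of c] c by (simp add: bins_def flip: of_nat_add)
        have "log 2 p \<le> log 2 (1 - p)" using p by simp
        then have "real (count_list c False) * log 2 p \<le> real (count_list c False) * log 2 (1 - p)"
          by (intro mult_left_mono) auto
        then have "real m * log 2 p
          \<le> real (count_list c True) * log 2 p + real (count_list c False) * log 2 (1 - p)"
          unfolding l by (simp add: algebra_simps)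
        then show "1 / type_profile p c \<le> 2 powr (real m * rate p s)"
          using p by (simp add: type_profile_powr[OF _ _ c m] rr powr_minus_divide[symmetric])
      qed
      also have "\<dots> = real M * 2 powr (real m * rate p s)" by (simp add: B(2))
      finally show ?thesis by (rule order_trans) (simp add: mult.commute)
    qed
  qed
  then show ?thesis using M unfolding sum[unfolded M_def] M_def by (simp add: divide_le_eq)
qed

section \<open>Lower bound for the average\<close>

text \<open>A single type class suffices, its size being estimated by
  \<open>log_binomial_ge\<close>. The \<open>min 0\<close> reflects that the class may be larger or
  smaller than the number of users.\<close>

lemma average_inverse_ge:
  fixes p s :: real
  assumes p: "0 < p" "p \<le> 1 / 2" and s: "1 / 2 \<le> s" "s \<le> 1" and k: "0 < k" "k \<le> m"
    and b: "bin_order m (type_profile p) b"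
  shows "2 powr (min 0 (real m * (binary_entropy (real k / real m) - binary_entropy s) - log 2 (real m + 1))
        + real m * cross_entropy (real k / real m) p)
    \<le> (\<Sum>i = 1..num_users s m. 1 / type_profile p (b i)) / real (num_users s m)"
proof -
  define M where "M = num_users s m"
  define T where "T = {c \<in> bins m. count_list c True = k}"
  have m: "1 \<le> m" using k by simp
  have M: "1 \<le> M" "real M \<le> 2 powr (real m * binary_entropy s)" "M \<le> 2 ^ m"
    using num_users_bounds[of s m] s by (auto simp: M_def)
  define v where "v = 2 powr (- (real m * cross_entropy (real k / real m) p))"
  have "type_profile p c = v" if "c \<in> T" for c
  proof -
    have c: "c \<in> bins m" and T: "count_list c True = k" using that by (auto simp: T_def)
    have "count_list c False = m - k" using count_True_False[of c] c T by (simp add: bins_def)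
    then have F: "real (count_list c False) = real m - real k" using k by simp
    have "type_profile p c = 2 powr (real k * log 2 p + (real m - real k) * log 2 (1 - p))"
      using p type_profile_powr[OF _ _ c m, of p] unfolding T F by simp
    then show ?thesis
      using m unfolding v_def cross_entropy_def by (simp add: algebra_simps)
  qed
  then have main: "min (real M) (real (m choose k)) / v \<le> (\<Sum>i = 1..M. 1 / type_profile p (b i))"
    using sum_least_likely_ge[OF b type_profile_pos M(1,3), of T v]
    by (auto simp: T_def card_type_class v_def)
  define e where "e = real m * (binary_entropy (real k / real m) - binary_entropy s) - log 2 (real m + 1)"
  have C: "0 < real (m choose k)" using k by simp
  have "2 powr e * real M \<le> 2 powr e * 2 powr (real m * binary_entropy s)"
    using M by (intro mult_left_mono) auto
  also have "\<dots> = 2 powr (real m * binary_entropy (real k / real m) - log 2 (real m + 1))"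
    by (simp add: e_def powr_add[symmetric] algebra_simps)
  also have "\<dots> \<le> 2 powr (log 2 (real (m choose k)))"
    using log_binomial_ge[OF k] by (intro powr_mono) auto
  also have "\<dots> = real (m choose k)" using C by simp
  finally have "2 powr e * real M \<le> real (m choose k)" .
  moreover have "2 powr (min 0 e) * real M \<le> 2 powr e * real M"
    by (intro mult_right_mono powr_mono) auto
  moreover have "2 powr (min 0 e) * real M \<le> 1 * real M"
    using powr_mono[of "min 0 e" 0 2] by (intro mult_right_mono) auto
  ultimately have "2 powr (min 0 e) * real M \<le> min (real M) (real (m choose k))" by simp
  then have "2 powr (min 0 e) * real M / v \<le> min (real M) (real (m choose k)) / v"
    by (rule divide_right_mono) (simp add: v_def)
  then have "2 powr (min 0 e) * real M / v \<le> (\<Sum>i = 1..M. 1 / type_profile p (b i))"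
    using main by (rule order_trans)
  moreover have "2 powr (min 0 e + real m * cross_entropy (real k / real m) p) = 2 powr (min 0 e) / v"
    by (simp add: v_def powr_add powr_minus_divide)
  ultimately show ?thesis
    using M(1) unfolding M_def[symmetric] e_def[symmetric] by (simp add: le_divide_eq)
qed

text \<open>Since \<open>p \<le> 1 / 2\<close>, no bin is less likely than \<open>p ^ m\<close>, the
  value for all ones. The lower bound on \<open>n\<close> then makes every preimage larger than
  \<open>2 powr (m * binary_entropy s)\<close>.\<close>

lemma two_num_users_le:
  fixes p s \<epsilon> :: real
  assumes p: "0 < p" "p \<le> 1 / 2" and s: "0 \<le> s" "s \<le> 1" and e: "0 < \<epsilon>" and m: "1 \<le> m"
    and n: "real n \<ge> (1 + \<epsilon>) * real m * (log 2 (1 / p) + binary_entropy s)"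
    and h: "h \<in> profile_set n m (type_profile p)" and c: "c \<in> bins m"
  shows "2 * real (num_users s m) \<le> 2 ^ n * type_profile p c"
proof -
  define K where "K = card {i \<in> inputs n. h i = c}"
  have K: "2 ^ n * type_profile p c = real K"
    using h c by (auto simp: profile_set_def hash_profile_def K_def field_simps)
  have a: "0 < log 2 (1 / p)" using p by simp
  have H: "0 \<le> binary_entropy s" by (rule binary_entropy_nonneg[OF s])
  have l: "real m = real (count_list c True) + real (count_list c False)"
    using count_True_False[of c] c by (simp add: bins_def flip: of_nat_add)
  have "log 2 p \<le> log 2 (1 - p)" using p by simp
  then have "real (count_list c False) * log 2 p \<le> real (count_list c False) * log 2 (1 - p)"
    by (intro mult_left_mono) auto
  then have t: "- real m * log 2 (1 / p)
      \<le> real (count_list c True) * log 2 p + real (count_list c False) * log 2 (1 - p)"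
    unfolding l using p by (simp add: log_divide algebra_simps)
  have "0 < \<epsilon> * real m * (log 2 (1 / p) + binary_entropy s)"
    using e m a H by (intro mult_pos_pos) auto
  then have ex: "real m * binary_entropy s
      < real n + (real (count_list c True) * log 2 p + real (count_list c False) * log 2 (1 - p))"
    using n t by (simp add: algebra_simps)
  have "real K = 2 powr (real n + (real (count_list c True) * log 2 p + real (count_list c False) * log 2 (1 - p)))"
    using p by (simp add: K[symmetric] type_profile_powr[OF _ _ c m] powr_add powr_realpow)
  then have gt: "2 powr (real m * binary_entropy s) < real K"
    using ex by simp
  have "1 \<le> 2 powr (real m * binary_entropy s)" using H by (intro ge_one_powr_ge_zero) auto
  \<comment> \<open>Preimage sizes are integers, so more than one element means at least two. This
    settles the case in which \<open>num_users\<close> is raised to \<open>1\<close>.\<close>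
  then have "1 < real K" using gt by (rule le_less_trans)
  then have K2: "2 \<le> real K" by simp
  have "real (nat \<lfloor>2 powr (binary_entropy s * real m - 1)\<rfloor>) \<le> 2 powr (binary_entropy s * real m - 1)"
    by simp
  also have "\<dots> = 2 powr (real m * binary_entropy s) / 2" by (simp add: powr_diff mult.commute)
  finally show ?thesis using gt K2 unfolding K num_users_def of_nat_max by auto
qed

section \<open>The limit of the normalised logarithm\<close>

lemma binary_entropy_tendsto:
  assumes "0 < t" "t < 1" "(q \<longlongrightarrow> t) F"
  shows "((\<lambda>m. binary_entropy (q m)) \<longlongrightarrow> binary_entropy t) F"
  unfolding binary_entropy_def using assms by (auto intro!: tendsto_intros)

lemma floor_fraction_tendsto:
  fixes t :: real
  assumes t: "0 \<le> t"
  shows "(\<lambda>m. real (nat \<lfloor>t * real m\<rfloor>) / real m) \<longlonglongrightarrow> t"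
proof (rule tendsto_sandwich)
  show "(\<lambda>m. t - 1 / real m) \<longlonglongrightarrow> t" by real_asymp
  show "\<forall>\<^sub>F m in sequentially. t - 1 / real m \<le> real (nat \<lfloor>t * real m\<rfloor>) / real m"
    using eventually_gt_at_top[of 0]
  proof eventually_elim
    case (elim m)
    have "t * real m - 1 \<le> real (nat \<lfloor>t * real m\<rfloor>)" by linarith
    from divide_right_mono[OF this, of "real m"] show ?case using elim by (simp add: diff_divide_distrib)
  qed
  show "\<forall>\<^sub>F m in sequentially. real (nat \<lfloor>t * real m\<rfloor>) / real m \<le> t"
    using eventually_gt_at_top[of 0]
  proof eventually_elim
    case (elim m)
    have "0 \<le> t * real m" using t by simp
    then have "real (nat \<lfloor>t * real m\<rfloor>) \<le> t * real m" by linarith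
    then show ?case using elim by (simp add: field_simps)
  qed
qed simp

text \<open>Constant factors vanish in the limit. The lower bound follows the types
  \<open>k m / m\<close>, which converge to the dominant type \<open>t\<close>.\<close>

lemma tendsto_rate:
  fixes p s :: real and G :: "nat \<Rightarrow> real"
  assumes p: "0 < p" "p \<le> 1 / 2" and s: "1 / 2 \<le> s" "s \<le> 1"
    and b: "\<And>m. 1 \<le> m \<Longrightarrow> bin_order m (type_profile p) (b m)"
  defines "A \<equiv> \<lambda>m. (\<Sum>i = 1..num_users s m. 1 / type_profile p (b m i)) / real (num_users s m)"
  assumes G: "\<And>m. 1 \<le> m \<Longrightarrow> A m / 2 \<le> G m" "\<And>m. 1 \<le> m \<Longrightarrow> G m \<le> 4 * A m"
  shows "(\<lambda>m. 1 / real m * log 2 (G m)) \<longlonglongrightarrow> rate p s"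
proof -
  define t where "t = max s (1 - p)"
  have t: "1 / 2 \<le> t" "t \<le> 1" "s \<le> t" using p s unfolding t_def by linarith+
  define k where "k m = nat \<lfloor>t * real m\<rfloor>" for m
  define q where "q m = real (k m) / real m" for m
  define e where "e m = min 0 (binary_entropy (q m) - binary_entropy s - log 2 (real m + 1) / real m)
    + cross_entropy (q m) p" for m
  have q: "q \<longlonglongrightarrow> t" unfolding q_def k_def using t by (intro floor_fraction_tendsto) auto
  \<comment> \<open>At \<open>t = 1\<close> the logarithm of \<open>1 - q\<close> is taken at
    \<open>0\<close>, where continuity of \<open>log\<close> fails; there \<open>q\<close> is
    eventually constant.\<close>
  have Hq: "(\<lambda>m. binary_entropy (q m)) \<longlonglongrightarrow> binary_entropy t"
  proof (cases "t = 1")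
    case True
    have "q m = 1" if "0 < m" for m using that True by (simp add: q_def k_def)
    then have "\<forall>\<^sub>F m in sequentially. binary_entropy (q m) = binary_entropy t"
      using True by (intro eventually_mono[OF eventually_gt_at_top[of 0]]) auto
    then show ?thesis by (rule tendsto_eventually)
  next
    case False
    then show ?thesis using t q by (intro binary_entropy_tendsto) auto
  qed
  have "(\<lambda>m. log 2 (real m + 1) / real m) \<longlonglongrightarrow> 0" by real_asymp
  then have "e \<longlonglongrightarrow> min 0 (binary_entropy t - binary_entropy s - 0) + cross_entropy t p"
    unfolding e_def cross_entropy_def by (intro tendsto_intros Hq q)
  \<comment> \<open>So the minimum in the limit is the entropy difference, as \<open>rate_eq\<close>
    requires.\<close>
  moreover have "binary_entropy t \<le> binary_entropy s" using s t by (intro binary_entropy_antimono) auto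
  ultimately have e_lim: "e \<longlonglongrightarrow> rate p s" unfolding rate_eq[OF p s] by (simp add: t_def)
  \<comment> \<open>From \<open>m = 2\<close> on, \<open>t \<ge> 1 / 2\<close> gives
    \<open>t * m \<ge> 1\<close>, so the floor is positive.\<close>
  have k: "0 < k m" "k m \<le> m" if "2 \<le> m" for m
  proof -
    have "1 / 2 * 2 \<le> t * real m" using t that by (intro mult_mono) auto
    then show "0 < k m" by (simp add: k_def)
    have "t * real m \<le> real m" using t by (simp add: mult_left_le_one_le)
    then show "k m \<le> m" unfolding k_def by linarith
  qed
  have lower: "e m - 1 / real m \<le> 1 / real m * log 2 (G m)" if m: "2 \<le> m" for m
  proof -
    have "real m * e m = min 0 (real m * (binary_entropy (q m) - binary_entropy s) - log 2 (real m + 1))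
        + real m * cross_entropy (q m) p"
      using m by (simp add: e_def distrib_left min_mult_distrib_left right_diff_distrib)
    then have "2 powr (real m * e m) \<le> A m"
      using average_inverse_ge[OF p s k[OF m] b, of] m unfolding A_def q_def by simp
    then have "2 powr (real m * e m - 1) \<le> G m"
      using G(1)[of m] m by (simp add: powr_diff)
    then have "real m * e m - 1 \<le> log 2 (G m)"
      by (subst le_log_iff) (auto intro: less_le_trans[of 0 "2 powr (real m * e m - 1)"])
    from divide_right_mono[OF this, of "real m"] show ?thesis using m by (simp add: diff_divide_distrib)
  qed
  have Gpos: "0 < G m" if m: "2 \<le> m" for m
  proof -
    have "1 \<le> num_users s m" using s by (intro num_users_bounds) auto
    then have "0 < A m" unfolding A_def
      by (intro divide_pos_pos sum_pos) (auto simp: type_profile_pos)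
    then show ?thesis using G(1)[of m] m by simp
  qed
  have upper: "1 / real m * log 2 (G m) \<le> rate p s + log 2 20 / real m" if m: "2 \<le> m" for m
  proof -
    have o: "bij_betw (b m) {1..2 ^ m} (bins m)" using b[of m] m by (simp add: bin_order_def)
    have sub: "{1..num_users s m} \<subseteq> {1..2 ^ m}" using num_users_bounds(4)[of s m] s by simp
    have "A m \<le> 5 * 2 powr (real m * rate p s)"
      unfolding A_def
    proof (rule average_inverse_le[OF p s])
      show "inj_on (b m) {1..num_users s m}"
        using bij_betw_imp_inj_on[OF o] sub by (rule inj_on_subset)
      show "b m ` {1..num_users s m} \<subseteq> bins m"
        using bij_betw_imp_surj_on[OF o] sub by blast
    qed (use m in simp)
    \<comment> \<open>The \<open>20\<close> combines the \<open>4\<close> of the hypothesis on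
      \<open>G\<close> with the \<open>5\<close> of \<open>average_inverse_le\<close>.\<close>
    then have "G m \<le> 20 * 2 powr (real m * rate p s)" using G(2)[of m] m by simp
    then have "log 2 (G m) \<le> log 2 (20 * 2 powr (real m * rate p s))"
      using Gpos[OF m] by simp
    also have "\<dots> = log 2 20 + real m * rate p s" by (subst log_mult_pos) auto
    finally show ?thesis using m by (simp add: field_simps)
  qed
  show ?thesis
  proof (rule tendsto_sandwich)
    show "\<forall>\<^sub>F m in sequentially. e m - 1 / real m \<le> 1 / real m * log 2 (G m)"
      using eventually_ge_at_top[of 2] by eventually_elim (rule lower)
    show "\<forall>\<^sub>F m in sequentially. 1 / real m * log 2 (G m) \<le> rate p s + log 2 20 / real m"
      using eventually_ge_at_top[of 2] by eventually_elim (rule upper)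
    have "(\<lambda>m. 1 / real m) \<longlonglongrightarrow> 0" by real_asymp
    from tendsto_diff[OF e_lim this] show "(\<lambda>m. e m - 1 / real m) \<longlonglongrightarrow> rate p s" by simp
    show "(\<lambda>m. rate p s + log 2 20 / real m) \<longlonglongrightarrow> rate p s" by real_asymp
  qed
qed

theorem theorem6:
  fixes p s \<epsilon> :: real
    and n :: "nat \<Rightarrow> nat"
    and b :: "nat \<Rightarrow> nat \<Rightarrow> bool list"
  assumes "0 < p" and "p \<le> 1 / 2"
    and "1 / 2 \<le> s" and "s \<le> 1"
    and "0 < \<epsilon>"
    and "\<And>m. m \<ge> 1 \<Longrightarrow>
           real (n m) \<ge> (1 + \<epsilon>) * real m * (log 2 (1 / p) + binary_entropy s)"
    and "\<And>m. m \<ge> 1 \<Longrightarrow> profile_set (n m) m (type_profile p) \<noteq> {}"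
    and "\<And>m. m \<ge> 1 \<Longrightarrow> bin_order m (type_profile p) (b m)"
  defines "L \<equiv> (if 1 - p \<le> s then binary_entropy s + binary_divergence s p
                 else 2 * binary_entropy p + binary_divergence (1 - p) p - binary_entropy s)"
  shows "(\<forall>\<pi>. (\<forall>m\<ge>1. \<pi> m \<in> strategies (n m)) \<longrightarrow>
            (\<lambda>m. 1 / real m * log 2 (guesswork_random_hash (n m) m (type_profile p)
                (num_users s m) (b m) (\<pi> m))) \<longlonglongrightarrow> L)
       \<and> (\<forall>h. (\<forall>m\<ge>1. h m \<in> profile_set (n m) m (type_profile p)) \<longrightarrow>
            (\<lambda>m. 1 / real m * log 2 (guesswork_random_strategy (n m)
                (num_users s m) (b m) (h m))) \<longlonglongrightarrow> L)"
proof -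
  define A where "A m = (\<Sum>i = 1..num_users s m. 1 / type_profile p (b m i)) / real (num_users s m)" for m
  have strategy: "A m / 2 \<le> guesswork_random_strategy (n m) (num_users s m) (b m) h"
    "guesswork_random_strategy (n m) (num_users s m) (b m) h \<le> 4 * A m"
    if m: "1 \<le> m" and h: "h \<in> profile_set (n m) m (type_profile p)" for m h
  proof -
    have M: "1 \<le> num_users s m" "num_users s m \<le> 2 ^ m" using num_users_bounds[of s m] assms(3,4) by auto
    have big: "2 * real (num_users s m) \<le> 2 ^ n m * type_profile p c" if "c \<in> bins m" for c
      using assms(1-5) by (intro two_num_users_le[OF _ _ _ _ _ m assms(6)[OF m] h that]) auto
    show "A m / 2 \<le> guesswork_random_strategy (n m) (num_users s m) (b m) h"
      "guesswork_random_strategy (n m) (num_users s m) (b m) h \<le> 4 * A m"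
      unfolding A_def by (rule guesswork_random_strategy_bounds[OF assms(8)[OF m] h M big]; assumption)+
  qed
  have limit: "(\<lambda>m. 1 / real m * log 2 (G m)) \<longlonglongrightarrow> L"
    if "\<And>m. 1 \<le> m \<Longrightarrow> A m / 2 \<le> G m" "\<And>m. 1 \<le> m \<Longrightarrow> G m \<le> 4 * A m" for G
    using tendsto_rate[OF assms(1-4,8), of G] that unfolding L_def rate_def A_def by simp
  show ?thesis
  \<comment> \<open>Both kinds of guesswork lie between \<open>A m / 2\<close> and
    \<open>4 * A m\<close>: directly for a random strategy, and as an average of such values for a
    random hash function.\<close>
  proof (intro conjI allI impI limit)
    fix \<pi> and m :: nat
    assume \<pi>: "\<forall>m\<ge>1. \<pi> m \<in> strategies (n m)" and m: "1 \<le> m"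
    then have \<pi>m: "\<pi> m \<in> strategies (n m)" by simp
    show "A m / 2 \<le> guesswork_random_hash (n m) m (type_profile p) (num_users s m) (b m) (\<pi> m)"
      "guesswork_random_hash (n m) m (type_profile p) (num_users s m) (b m) (\<pi> m) \<le> 4 * A m"
      by (rule guesswork_random_hash_bounds[OF assms(7)[OF m] \<pi>m strategy[OF m]]; assumption)+
  next
    fix h and m :: nat
    assume h: "\<forall>m\<ge>1. h m \<in> profile_set (n m) m (type_profile p)" and m: "1 \<le> m"
    then show "A m / 2 \<le> guesswork_random_strategy (n m) (num_users s m) (b m) (h m)"
      "guesswork_random_strategy (n m) (num_users s m) (b m) (h m) \<le> 4 * A m"
      using strategy[OF m] by blast+
  qed
qed

end
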